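(* For every sink-final $\Sigma1$-PSM $M$ there is a global type $G$ with the same core language, i.e. $\mathcal{L}(\mathrm{GAut}(G))=\mathcal{L}(M)$ (and hence with the same semantics, $\mathcal{C}(\mathcal{L}(\mathrm{GAut}(G)))=\mathcal{S}(M)$). If $M$ is non-deterministic (mixed-choice, sender-driven, or directed, respectively), then $G$ is non-deterministic (mixed-choice, sender-driven, or directed, respectively).
   Context: **Events.** Fix a finite set $\mathcal{P}$ of participants and a finite set $\mathcal{V}$ of messages. For distinct $p,q\in\mathcal{P}$ and $m\in\mathcal{V}$, $\mathsf{snd}(p,q,m)$ is the event "$p$ sends $m$ to $q$" and $\mathsf{rcv}(p,q,m)$ is "$q$ receives $m$ from $p$"; $\Sigma$ is the set of all events, $\Sigma^\infty=\Sigma^*\cup\Sigma^\omega$. The paired event $p\to q:m$ abbreviates the word $\mathsf{snd}(p,q,m)\cdot\mathsf{rcv}(p,q,m)$. For a word $w$, $w{\Downarrow}_{\mathsf{snd}(p,q,\_)}$ (resp. $w{\Downarrow}_{\mathsf{rcv}(p,q,\_)}$) is the subsequence of sends from $p$ to $q$ (resp. receives by $q$ from $p$), and $\mathcal{V}(\cdot)$ extracts the sequence of messages. **FIFO.** $w\in\Sigma^\infty$ is channel-compliant if for every finite prefix $w'$ and all $p,q$, $\mathcal{V}(w'{\Downarrow}_{\mathsf{rcv}(p,q,\_)})$ is a prefix of $\mathcal{V}(w'{\Downarrow}_{\mathsf{snd}(p,q,\_)})$. $\mathrm{FIFO}$ is the set of infinite channel-compliant words and of finite channel-compliant words with $\mathcal{V}(w{\Downarrow}_{\mathsf{snd}(p,q,\_)})=\mathcal{V}(w{\Downarrow}_{\mathsf{rcv}(p,q,\_)})$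 for all $p,q$. A word is $B$-bounded if for every prefix $w'$ and all $p,q$: $|w'{\Downarrow}_{\mathsf{snd}(p,q,\_)}|-|w'{\Downarrow}_{\mathsf{rcv}(p,q,\_)}|\le B$, and $\Sigma B$-bounded if the sum of these differences over all $p\neq q$ is $\le B$ for every prefix. **Feasible eventual reception.** In $w=w_1w_2\dots$, a send $w_i=\mathsf{snd}(p,q,m)$ is matched by $w_j=\mathsf{rcv}(p,q,m)$ if $i<j$ and $\mathcal{V}((w_1\dots w_i){\Downarrow}_{\mathsf{snd}(p,q,\_)})=\mathcal{V}((w_1\dots w_j){\Downarrow}_{\mathsf{rcv}(p,q,\_)})$. A language $L$ satisfies feasible eventual reception if for every finite prefix $w$ of a word in $L$ and every unmatched send in $w$ there is $w'\in L$ extending $w$ in which that send is matched. **State machines.** A finite state machine $(Q,\Delta,\delta,q_0,F)$ has $\delta\subseteq Q\times(\Delta\cup\{\varepsilon\})\times Q$. Runs start in $q_0$; a run is maximal if infinite or ending in a final state; the (core) language $\mathcal{L}(A)$ is the set of traces of maximal runs. It is dense if any state with an outgoing $\varepsilon$-transition has exactly one outgoing transition; a dense machine is deterministic if $(q,a,q'),(q,a,q'')\in\delta$ implies $q'=q''$. It is sink-final if a state is final iff it has no outgoing transition. **PSM.** A PSM is a dense finite state machine $M$ over $\Sigma$ such that for some $B$, $\mathcal{L}(M)$ consists of $B$-bounded words of $\mathrm{FIFO}$ and satisfies feasible eventual reception. Its semantics is $\mathcal{S}(M)=\mathcal{C}(\mathcal{L}(M))$, where $\mathcal{C}$ is the closure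 under the indistinguishability relation: $\sim$ is the smallest equivalence relation on $\Sigma^*$ allowing, within any word $w\cdot x\cdot y\cdot u$, to swap adjacent $x,y$ when: (1) $x=\mathsf{snd}(p,q,m)$, $y=\mathsf{snd}(r,s,m')$, $p\ne r$; (2) $x=\mathsf{rcv}(p,q,m)$, $y=\mathsf{rcv}(r,s,m')$, $q\ne s$; (3) $x=\mathsf{snd}(p,q,m)$, $y=\mathsf{rcv}(r,s,m')$, $p\neq s$ and ($p\ne r$ or $q\neq s$); (4) $x=\mathsf{snd}(p,q,m)$, $y=\mathsf{rcv}(p,q,m')$ and $|w{\Downarrow}_{\mathsf{snd}(p,q,\_)}|>|w{\Downarrow}_{\mathsf{rcv}(p,q,\_)}|$. $\mathcal{C}(L)$ contains the finite words $w'\sim w$ with $w\in L$ finite, and the infinite words $w'$ for which some infinite $w\in L$ satisfies: each finite prefix $u'$ of $w'$ has $u'v\sim v'$ for some $v\in\Sigma^*$ and some finite prefix $v'$ of $w$. A $\Sigma1$-PSM is a PSM whose core language consists of $\Sigma1$-bounded words; its transitions may be labelled by paired events. **Choice restrictions for PSMs.** Mixed-choice: deterministic. Sender-driven: at every state with more than one outgoing transition, all outgoing transitions are sends (or paired events) with one common sender and have pairwise distinct labels. Directed: sender-driven, and the receiver is also common to all transitions of such a state. Non-deterministic: no choice restriction required. **Global types.** $G::=0\mid\sum_{i\in I}p_i\to q_i:m_i.\,G_i\mid\mu X.\,G\mid X$, with $I$ finite non-empty, every recursion variable bound, distinct binders using distinct variables, and recursion guarded (at least one interaction between $\mu X$ and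 each use of $X$). $\mathrm{GAut}(G)$ is the state machine over paired events whose states are the (occurrences of) syntactic subterms of $G$, with initial state $G$, final states the occurrences of $0$, and transitions: from $\sum_{i\in I}p_i\to q_i:m_i.G_i$ to $G_i$ labelled $p_i\to q_i:m_i$; from $\mu X.G'$ to $G'$ labelled $\varepsilon$; from $X$ to its binder $\mu X.G'$ labelled $\varepsilon$. Its traces are read as words over $\Sigma$. A global type is mixed-choice if in each subterm $\sum_{i\in I}p_i\to q_i:m_i.G_i$ the triples $(p_i,q_i,m_i)$ are pairwise distinct; sender-driven if moreover all $p_i$ are equal; directed if all $p_i$ are equal, all $q_i$ are equal, and the $m_i$ are pairwise distinct; non-deterministic: no choice restriction required. *)

theory Defs
  imports Main "HOL-Library.Sublist" "HOL-Library.Infinite_Set"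
begin

section \<open>Finite and infinite words\<close>

datatype 'a fiword = Fin "'a list" | Inf "nat \<Rightarrow> 'a"

fun fin_prefixes :: "'a fiword \<Rightarrow> 'a list set" where
  "fin_prefixes (Fin u) = {v. prefix v u}"
| "fin_prefixes (Inf f) = range (\<lambda>n. map f [0..<n])"

fun letters :: "'a fiword \<Rightarrow> 'a set" where
  "letters (Fin u) = set u"
| "letters (Inf f) = range f"


section \<open>Events\<close>

text \<open>Participants and messages are the elements of types of class \<open>finite\<close>.
  \<open>Rcv p q m\<close> is the event that \<open>q\<close> receives \<open>m\<close> from \<open>p\<close>, so the sender comes first in both
  constructors.\<close>

datatype ('p, 'v) event =
    is_Snd: Snd (sender: 'p) (receiver: 'p) (msg: 'v)
  | is_Rcv: Rcv (sender: 'p) (receiver: 'p) (msg: 'v)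

definition Sigma_ev :: "('p, 'v) event set" where
  "Sigma_ev = {e. sender e \<noteq> receiver e}"

definition snds :: "'p \<Rightarrow> 'p \<Rightarrow> ('p, 'v) event list \<Rightarrow> ('p, 'v) event list" where
  "snds p q w = filter (\<lambda>e. is_Snd e \<and> sender e = p \<and> receiver e = q) w"

definition rcvs :: "'p \<Rightarrow> 'p \<Rightarrow> ('p, 'v) event list \<Rightarrow> ('p, 'v) event list" where
  "rcvs p q w = filter (\<lambda>e. is_Rcv e \<and> sender e = p \<and> receiver e = q) w"

definition msgs :: "('p, 'v) event list \<Rightarrow> 'v list" where
  "msgs w = map msg w"


section \<open>FIFO words, boundedness, feasible eventual reception\<close>

definition channel_compliant :: "('p, 'v) event fiword \<Rightarrow> bool" where
  "channel_compliant w \<longleftrightarrow>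
     (\<forall>u \<in> fin_prefixes w. \<forall>p q. prefix (msgs (rcvs p q u)) (msgs (snds p q u)))"

definition FIFO :: "('p, 'v) event fiword set" where
  "FIFO = {w. letters w \<subseteq> Sigma_ev \<and> channel_compliant w \<and>
     (\<forall>u. w = Fin u \<longrightarrow> (\<forall>p q. msgs (snds p q u) = msgs (rcvs p q u)))}"

definition in_flight :: "'p \<Rightarrow> 'p \<Rightarrow> ('p, 'v) event list \<Rightarrow> int" where
  "in_flight p q u = int (length (snds p q u)) - int (length (rcvs p q u))"

definition bounded_word :: "nat \<Rightarrow> ('p, 'v) event fiword \<Rightarrow> bool" where
  "bounded_word B w \<longleftrightarrow> (\<forall>u \<in> fin_prefixes w. \<forall>p q. in_flight p q u \<le> int B)"

definition sum_bounded_word :: "nat \<Rightarrow> ('p::finite, 'v) event fiword \<Rightarrow> bool" where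
  "sum_bounded_word B w \<longleftrightarrow>
     (\<forall>u \<in> fin_prefixes w. (\<Sum>(p, q) \<in> {(p, q). p \<noteq> q}. in_flight p q u) \<le> int B)"

text \<open>Positions are counted from 0, so the prefix that ends with the letter at position \<open>i\<close> is
  \<open>take (Suc i)\<close>.\<close>

definition matched_by :: "('p, 'v) event list \<Rightarrow> nat \<Rightarrow> nat \<Rightarrow> bool" where
  "matched_by u i j \<longleftrightarrow> i < j \<and> j < length u \<and>
     (\<exists>p q m. u ! i = Snd p q m \<and> u ! j = Rcv p q m \<and>
        msgs (snds p q (take (Suc i) u)) = msgs (rcvs p q (take (Suc j) u)))"

definition matched :: "('p, 'v) event fiword \<Rightarrow> nat \<Rightarrow> bool" where
  "matched w i \<longleftrightarrow> (\<exists>u \<in> fin_prefixes w. \<exists>j. matched_by u i j)"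

definition feasible_eventual_reception :: "('p, 'v) event fiword set \<Rightarrow> bool" where
  "feasible_eventual_reception L \<longleftrightarrow>
     (\<forall>W \<in> L. \<forall>w \<in> fin_prefixes W. \<forall>i < length w.
        is_Snd (w ! i) \<and> \<not> matched (Fin w) i \<longrightarrow>
        (\<exists>W' \<in> L. w \<in> fin_prefixes W' \<and> matched W' i))"


section \<open>Finite state machines\<close>

text \<open>The label \<open>None\<close> is \<open>\<epsilon>\<close>.\<close>

record ('s, 'a) fsm =
  states :: "'s set"
  delta :: "('s \<times> 'a option \<times> 's) set"
  start :: 's
  finals :: "'s set"

definition is_fsm :: "'a set \<Rightarrow> ('s, 'a) fsm \<Rightarrow> bool" where
  "is_fsm A M \<longleftrightarrow> finite (states M) \<and>
     delta M \<subseteq> states M \<times> (insert None (Some ` A)) \<times> states M \<and>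
     start M \<in> states M \<and> finals M \<subseteq> states M"

definition outgoing :: "('s, 'a) fsm \<Rightarrow> 's \<Rightarrow> ('s \<times> 'a option \<times> 's) set" where
  "outgoing M s = {t \<in> delta M. fst t = s}"

fun fin_path :: "('s, 'a) fsm \<Rightarrow> 's \<Rightarrow> ('s \<times> 'a option \<times> 's) list \<Rightarrow> 's \<Rightarrow> bool" where
  "fin_path M s [] s' \<longleftrightarrow> s' = s"
| "fin_path M s (t # ts) s' \<longleftrightarrow> t \<in> outgoing M s \<and> fin_path M (snd (snd t)) ts s'"

definition inf_run :: "('s, 'a) fsm \<Rightarrow> (nat \<Rightarrow> 's) \<Rightarrow> (nat \<Rightarrow> 'a option) \<Rightarrow> bool" where
  "inf_run M r l \<longleftrightarrow> r 0 = start M \<and> (\<forall>i. (r i, l i, r (Suc i)) \<in> delta M)"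

definition fin_trace :: "('s \<times> 'a option \<times> 's) list \<Rightarrow> 'a list" where
  "fin_trace ts = List.map_filter (\<lambda>(s, a, s'). a) ts"

text \<open>An infinite run may have a finite trace: from some point on, all its labels are \<open>\<epsilon>\<close>.\<close>

definition inf_trace :: "(nat \<Rightarrow> 'a option) \<Rightarrow> 'a fiword" where
  "inf_trace l = (let I = {i. l i \<noteq> None} in
     if finite I then Fin (map (\<lambda>i. the (l i)) (sorted_list_of_set I))
     else Inf (\<lambda>n. the (l (enumerate I n))))"

definition lang :: "('s, 'a) fsm \<Rightarrow> 'a fiword set" where
  "lang M = {Fin (fin_trace ts) | ts s. fin_path M (start M) ts s \<and> s \<in> finals M}
          \<union> {inf_trace l | r l. inf_run M r l}"

definition dense :: "('s, 'a) fsm \<Rightarrow> bool" where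
  "dense M \<longleftrightarrow> (\<forall>s \<in> states M.
     (\<exists>s'. (s, None, s') \<in> delta M) \<longrightarrow> (\<exists>!t. t \<in> outgoing M s))"

definition deterministic :: "('s, 'a) fsm \<Rightarrow> bool" where
  "deterministic M \<longleftrightarrow>
     (\<forall>s a s' s''. (s, a, s') \<in> delta M \<and> (s, a, s'') \<in> delta M \<longrightarrow> s' = s'')"

definition sink_final :: "('s, 'a) fsm \<Rightarrow> bool" where
  "sink_final M \<longleftrightarrow> (\<forall>s \<in> states M. s \<in> finals M \<longleftrightarrow> outgoing M s = {})"


section \<open>Protocol state machines\<close>

definition psm :: "('s, ('p, 'v) event) fsm \<Rightarrow> bool" where
  "psm M \<longleftrightarrow> is_fsm Sigma_ev M \<and> dense M \<and>
     (\<exists>B. \<forall>w \<in> lang M. bounded_word B w \<and> w \<in> FIFO) \<and>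
     feasible_eventual_reception (lang M)"

text \<open>A machine with labels of type \<open>label\<close> may also use paired events. Since \<open>p \<rightarrow> q : m\<close>
  abbreviates the word \<open>snd(p,q,m) rcv(p,q,m)\<close>, a transition with this label abbreviates two
  consecutive transitions through an intermediate state of its own; \<open>unpair\<close> expands the
  abbreviation. Language, PSM conditions and choice restrictions all refer to the expansion. In
  particular, transitions labelled \<open>p \<rightarrow> q : m\<close> and \<open>snd(p,q,m)\<close> that leave the same state have
  the same first event and do not count as having distinct labels. If only one of the two kinds
  of labels is used, this agrees with comparing the labels themselves.\<close>

datatype ('p, 'v) label = Event "('p, 'v) event" | Paired 'p 'p 'v

definition Sigma_label :: "('p, 'v) label set" where
  "Sigma_label = Event ` Sigma_ev \<union> {Paired p q m | p q m. p \<noteq> q}"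

type_synonym ('s, 'p, 'v) ustate = "'s + 's \<times> ('p \<times> 'p \<times> 'v) \<times> 's"

definition unpair ::
  "('s, ('p, 'v) label) fsm \<Rightarrow> (('s, 'p, 'v) ustate, ('p, 'v) event) fsm" where
  "unpair M = \<lparr>
     states = Inl ` states M \<union>
       {Inr (s, (p, q, m), s') | s p q m s'. (s, Some (Paired p q m), s') \<in> delta M},
     delta =
       {(Inl s, None, Inl s') | s s'. (s, None, s') \<in> delta M} \<union>
       {(Inl s, Some e, Inl s') | s e s'. (s, Some (Event e), s') \<in> delta M} \<union>
       {(Inl s, Some (Snd p q m), Inr (s, (p, q, m), s')) | s p q m s'.
          (s, Some (Paired p q m), s') \<in> delta M} \<union>
       {(Inr (s, (p, q, m), s'), Some (Rcv p q m), Inl s') | s p q m s'.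
          (s, Some (Paired p q m), s') \<in> delta M},
     start = Inl (start M),
     finals = Inl ` finals M \<rparr>"

definition core_lang :: "('s, ('p, 'v) label) fsm \<Rightarrow> ('p, 'v) event fiword set" where
  "core_lang M = lang (unpair M)"

definition sigma1_psm :: "('s, ('p::finite, 'v::finite) label) fsm \<Rightarrow> bool" where
  "sigma1_psm M \<longleftrightarrow> is_fsm Sigma_label M \<and> psm (unpair M) \<and>
     (\<forall>w \<in> core_lang M. sum_bounded_word 1 w)"


section \<open>Indistinguishability and semantics\<close>

text \<open>\<open>swappable w x y\<close>: the adjacent letters \<open>x\<close>, \<open>y\<close> may be swapped when they follow \<open>w\<close>.\<close>

inductive swappable ::
  "('p, 'v) event list \<Rightarrow> ('p, 'v) event \<Rightarrow> ('p, 'v) event \<Rightarrow> bool" where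
  "p \<noteq> r \<Longrightarrow> swappable w (Snd p q m) (Snd r s m')"
| "q \<noteq> s \<Longrightarrow> swappable w (Rcv p q m) (Rcv r s m')"
| "p \<noteq> s \<Longrightarrow> p \<noteq> r \<or> q \<noteq> s \<Longrightarrow> swappable w (Snd p q m) (Rcv r s m')"
| "length (snds p q w) > length (rcvs p q w) \<Longrightarrow> swappable w (Snd p q m) (Rcv p q m')"

inductive swap1 :: "('p, 'v) event list \<Rightarrow> ('p, 'v) event list \<Rightarrow> bool" where
  "swappable w x y \<Longrightarrow> swap1 (w @ x # y # u) (w @ y # x # u)"

definition indist :: "('p, 'v) event list \<Rightarrow> ('p, 'v) event list \<Rightarrow> bool" where
  "indist = equivclp swap1"

definition closure_indist :: "('p, 'v) event fiword set \<Rightarrow> ('p, 'v) event fiword set" where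
  "closure_indist L =
     {Fin w' | w'. \<exists>w. Fin w \<in> L \<and> indist w' w} \<union>
     {Inf f' | f'. \<exists>f. Inf f \<in> L \<and>
        (\<forall>u' \<in> fin_prefixes (Inf f'). \<exists>v. \<exists>v' \<in> fin_prefixes (Inf f). indist (u' @ v) v')}"

definition semantics :: "('s, ('p, 'v) label) fsm \<Rightarrow> ('p, 'v) event fiword set" where
  "semantics M = closure_indist (core_lang M)"


section \<open>Global types\<close>

text \<open>In \<open>Choice bs\<close> the index set is the set of positions of the list \<open>bs\<close>, so branches may
  repeat. Recursion variables are natural numbers.\<close>

datatype ('p, 'v) gtype =
    End
  | Choice "(('p \<times> 'p \<times> 'v) \<times> ('p, 'v) gtype) list"
  | Mu nat "('p, 'v) gtype"
  | Var nat

text \<open>Occurrences of subterms are given by their positions: \<open>i\<close> selects the \<open>i\<close>-th branch of a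
  choice, \<open>0\<close> the body of a recursion.\<close>

fun subterm_at :: "('p, 'v) gtype \<Rightarrow> nat list \<Rightarrow> ('p, 'v) gtype option" where
  "subterm_at G [] = Some G"
| "subterm_at (Choice bs) (i # \<pi>) =
     (if i < length bs then subterm_at (snd (bs ! i)) \<pi> else None)"
| "subterm_at (Mu X G) (i # \<pi>) = (if i = 0 then subterm_at G \<pi> else None)"
| "subterm_at End (i # \<pi>) = None"
| "subterm_at (Var X) (i # \<pi>) = None"

definition all_choices ::
  "((('p \<times> 'p \<times> 'v) \<times> ('p, 'v) gtype) list \<Rightarrow> bool) \<Rightarrow> ('p, 'v) gtype \<Rightarrow> bool" where
  "all_choices P G \<longleftrightarrow> (\<forall>\<pi> bs. subterm_at G \<pi> = Some (Choice bs) \<longrightarrow> P bs)"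

definition binds :: "('p, 'v) gtype \<Rightarrow> nat list \<Rightarrow> nat \<Rightarrow> bool" where
  "binds G \<rho> X \<longleftrightarrow> (\<exists>G'. subterm_at G \<rho> = Some (Mu X G'))"

definition global_type :: "('p, 'v) gtype \<Rightarrow> bool" where
  "global_type G \<longleftrightarrow>
     all_choices (\<lambda>bs. bs \<noteq> [] \<and> (\<forall>((p, q, m), G') \<in> set bs. p \<noteq> q)) G \<and>
     (\<forall>\<pi> X. subterm_at G \<pi> = Some (Var X) \<longrightarrow> (\<exists>\<rho>. prefix \<rho> \<pi> \<and> binds G \<rho> X)) \<and>
     (\<forall>\<rho> \<rho>' X. binds G \<rho> X \<and> binds G \<rho>' X \<longrightarrow> \<rho> = \<rho>') \<and>
     (\<forall>\<pi> \<rho> X. subterm_at G \<pi> = Some (Var X) \<and> prefix \<rho> \<pi> \<and> binds G \<rho> X \<longrightarrow>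
        (\<exists>\<sigma> bs. prefix \<rho> \<sigma> \<and> prefix \<sigma> \<pi> \<and> subterm_at G \<sigma> = Some (Choice bs)))"

definition GAut :: "('p, 'v) gtype \<Rightarrow> (nat list, ('p, 'v) label) fsm" where
  "GAut G = \<lparr>
     states = {\<pi>. subterm_at G \<pi> \<noteq> None},
     delta =
       {(\<pi>, Some (Paired p q m), \<pi> @ [i]) | \<pi> i p q m. \<exists>bs G'.
          subterm_at G \<pi> = Some (Choice bs) \<and> i < length bs \<and> bs ! i = ((p, q, m), G')} \<union>
       {(\<pi>, None, \<pi> @ [0]) | \<pi>. \<exists>X G'. subterm_at G \<pi> = Some (Mu X G')} \<union>
       {(\<pi>, None, \<rho>) | \<pi> \<rho>. \<exists>X. subterm_at G \<pi> = Some (Var X) \<and> prefix \<rho> \<pi> \<and> binds G \<rho> X},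
     start = [],
     finals = {\<pi>. subterm_at G \<pi> = Some End} \<rparr>"


section \<open>Choice restrictions\<close>

datatype choice_class = Non_Deterministic | Mixed_Choice | Sender_Driven | Directed

definition branching :: "('s, 'a) fsm \<Rightarrow> 's \<Rightarrow> bool" where
  "branching M s \<longleftrightarrow> (\<exists>t \<in> outgoing M s. \<exists>t' \<in> outgoing M s. t \<noteq> t')"

definition sender_driven :: "('s, ('p, 'v) event) fsm \<Rightarrow> bool" where
  "sender_driven M \<longleftrightarrow> (\<forall>s \<in> states M. branching M s \<longrightarrow>
     (\<exists>p. \<forall>(s1, a, s2) \<in> outgoing M s. \<exists>q m. a = Some (Snd p q m)) \<and>
     inj_on (\<lambda>(s1, a, s2). a) (outgoing M s))"

definition directed :: "('s, ('p, 'v) event) fsm \<Rightarrow> bool" where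
  "directed M \<longleftrightarrow> sender_driven M \<and> (\<forall>s \<in> states M. branching M s \<longrightarrow>
     (\<exists>q. \<forall>(s1, a, s2) \<in> outgoing M s. \<exists>p m. a = Some (Snd p q m)))"

fun psm_choice :: "choice_class \<Rightarrow> ('s, ('p, 'v) label) fsm \<Rightarrow> bool" where
  "psm_choice Non_Deterministic M \<longleftrightarrow> True"
| "psm_choice Mixed_Choice M \<longleftrightarrow> deterministic (unpair M)"
| "psm_choice Sender_Driven M \<longleftrightarrow> sender_driven (unpair M)"
| "psm_choice Directed M \<longleftrightarrow> directed (unpair M)"

definition common :: "('a \<Rightarrow> 'b) \<Rightarrow> 'a list \<Rightarrow> bool" where
  "common f xs \<longleftrightarrow> (\<forall>x \<in> set xs. \<forall>y \<in> set xs. f x = f y)"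

fun gtype_choice :: "choice_class \<Rightarrow> ('p, 'v) gtype \<Rightarrow> bool" where
  "gtype_choice Non_Deterministic G \<longleftrightarrow> True"
| "gtype_choice Mixed_Choice G \<longleftrightarrow> all_choices (\<lambda>bs. distinct (map fst bs)) G"
| "gtype_choice Sender_Driven G \<longleftrightarrow>
     all_choices (\<lambda>bs. distinct (map fst bs) \<and> common (\<lambda>((p, q, m), G'). p) bs) G"
| "gtype_choice Directed G \<longleftrightarrow>
     all_choices (\<lambda>bs. common (\<lambda>((p, q, m), G'). p) bs \<and> common (\<lambda>((p, q, m), G'). q) bs \<and>
       distinct (map (\<lambda>((p, q, m), G'). m) bs)) G"

end

theory Submission
  imports Defs "HOL-Library.Countable"
begin

text \<open>Every reachable path of a sink-final machine extends to a word of its language. With at most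
  one message in flight, a send can therefore only be followed by the matching receive, and every
  word is a sequence of interactions \<open>p \<rightarrow> q : m\<close>. Contracting each send, its receive and the
  surrounding silent transitions to one step gives a finite graph labelled by interactions. Its
  unfolding into a tree, in which a state met before on the same branch becomes a recursion variable,
  is the required global type; states without steps, including those that only have an infinite
  silent run, become \<open>0\<close>. The nondeterminism of receives is moved to the preceding sends, so the
  machines are bisimilar for whole interactions but not for single events.\<close>

section \<open>Languages in terms of weak steps\<close>

text \<open>Density is what makes the contraction sound: a state with a silent exit has no other
  exit, so the silent path from a state is forced until it meets a visible transition. In a
  sink-final machine a state that offers an interaction therefore neither reaches a final state
  silently nor diverges, and \<open>End\<close> and \<open>Choice\<close> never compete for the same
  state. The forced paths also carry the choice restrictions over: all interactions offered by a
  state begin with transitions from one and the same state of the machine. Alternation of sends and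
  receives is what turns a relation that matches whole interactions into inclusion of languages over
  single events. The semantics needs no argument of its own, because the closure is a function of
  the core language.\<close>

abbreviation estep :: "('s, 'a) fsm \<Rightarrow> 's \<Rightarrow> 's \<Rightarrow> bool" where
  "estep M s s' \<equiv> (s, None, s') \<in> delta M"

text \<open>Silent moves are absorbed before the letter only. Those after the last letter of a word
  are left to \<open>terminates\<close>.\<close>

definition wstep :: "('s, 'a) fsm \<Rightarrow> 's \<Rightarrow> 'a \<Rightarrow> 's \<Rightarrow> bool" where
  "wstep M s a s' \<longleftrightarrow> (\<exists>u. (estep M)\<^sup>*\<^sup>* s u \<and> (u, Some a, s') \<in> delta M)"

fun wpath :: "('s, 'a) fsm \<Rightarrow> 's \<Rightarrow> 'a list \<Rightarrow> 's \<Rightarrow> bool" where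
  "wpath M s [] s' \<longleftrightarrow> s' = s"
| "wpath M s (a # w) s' \<longleftrightarrow> (\<exists>u. wstep M s a u \<and> wpath M u w s')"

definition diverges :: "('s, 'a) fsm \<Rightarrow> 's \<Rightarrow> bool" where
  "diverges M s \<longleftrightarrow> (\<exists>g. g 0 = s \<and> (\<forall>i. estep M (g i) (g (Suc i))))"

text \<open>An infinite run whose labels are silent from some point on has a finite trace, so a
  diverging state accepts the empty continuation just as a final state does.\<close>

definition terminates :: "('s, 'a) fsm \<Rightarrow> 's \<Rightarrow> bool" where
  "terminates M s \<longleftrightarrow> (\<exists>u. (estep M)\<^sup>*\<^sup>* s u \<and> (u \<in> finals M \<or> diverges M u))"

lemma rtranclp_unfold_left: "R\<^sup>*\<^sup>* s u \<longleftrightarrow> s = u \<or> (\<exists>v. R s v \<and> R\<^sup>*\<^sup>* v u)"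
  by (blast intro: converse_rtranclp_into_rtranclp elim: converse_rtranclpE)

lemma wstep_unfold:
  "wstep M s a s' \<longleftrightarrow> (s, Some a, s') \<in> delta M \<or> (\<exists>u. estep M s u \<and> wstep M u a s')"
  unfolding wstep_def by (subst rtranclp_unfold_left) blast

lemma diverges_unfold: "diverges M s \<longleftrightarrow> (\<exists>u. estep M s u \<and> diverges M u)"
proof
  assume "diverges M s"
  then obtain g where g: "g 0 = s" "\<forall>i. estep M (g i) (g (Suc i))"
    unfolding diverges_def by blast
  have "diverges M (g 1)"
    unfolding diverges_def using g(2) by (intro exI[of _ "\<lambda>i. g (Suc i)"]) auto
  then show "\<exists>u. estep M s u \<and> diverges M u"
    using g by (metis One_nat_def)
next
  assume "\<exists>u. estep M s u \<and> diverges M u"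
  then obtain u g where g: "estep M s u" "g 0 = u" "\<forall>i. estep M (g i) (g (Suc i))"
    unfolding diverges_def by blast
  then have "\<forall>i. estep M (case_nat s g i) (case_nat s g (Suc i))"
    by (simp split: nat.split)
  then show "diverges M s"
    unfolding diverges_def by (intro exI[of _ "case_nat s g"]) simp
qed

text \<open>A diverging state has a silent successor that diverges and so terminates, which covers
  divergence by the second disjunct. Termination of a concrete state can thus be computed from its
  silent successors.\<close>

lemma terminates_unfold:
  "terminates M s \<longleftrightarrow> s \<in> finals M \<or> (\<exists>u. estep M s u \<and> terminates M u)"
proof
  assume "terminates M s"
  then obtain u where u: "(estep M)\<^sup>*\<^sup>* s u" "u \<in> finals M \<or> diverges M u"
    unfolding terminates_def by blast
  from u(1) show "s \<in> finals M \<or> (\<exists>u. estep M s u \<and> terminates M u)"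
  proof (cases rule: converse_rtranclpE)
    case base
    then have "s \<in> finals M \<or> (\<exists>v. estep M s v \<and> diverges M v)"
      using u(2) diverges_unfold[of M s] by simp
    then show ?thesis unfolding terminates_def by blast
  next
    case (step v)
    then show ?thesis using u(2) unfolding terminates_def by blast
  qed
next
  assume "s \<in> finals M \<or> (\<exists>u. estep M s u \<and> terminates M u)"
  then show "terminates M s"
    unfolding terminates_def by (blast intro: converse_rtranclp_into_rtranclp)
qed

section \<open>Finite paths and weak paths\<close>

lemma wpath_append: "wpath M s (v @ w) s' \<longleftrightarrow> (\<exists>u. wpath M s v u \<and> wpath M u w s')"
  by (induction v arbitrary: s) auto

lemma fin_path_append: "fin_path M s (ts @ us) s' \<longleftrightarrow> (\<exists>u. fin_path M s ts u \<and> fin_path M u us s')"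
  by (induction ts arbitrary: s) auto

lemma fin_trace_simps [simp]:
  "fin_trace [] = []"
  "fin_trace ((s, None, s') # ts) = fin_trace ts"
  "fin_trace ((s, Some a, s') # ts) = a # fin_trace ts"
  by (simp_all add: fin_trace_def List.map_filter_simps)

lemma fin_trace_append [simp]: "fin_trace (ts @ us) = fin_trace ts @ fin_trace us"
  by (simp add: fin_trace_def List.map_filter_def)

text \<open>Every silent step goes with the next letter; the steps after the last letter form the
  silent remainder from \<open>u\<close> to \<open>s'\<close>.\<close>

lemma fin_path_wpath:
  assumes "fin_path M s ts s'"
  shows "\<exists>u. wpath M s (fin_trace ts) u \<and> (estep M)\<^sup>*\<^sup>* u s'"
  using assms
proof (induction ts arbitrary: s)
  case (Cons t ts)
  obtain l s1 where t: "t = (s, l, s1)" "(s, l, s1) \<in> delta M"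
    using Cons.prems by (cases t) (auto simp: outgoing_def)
  then obtain u where u: "wpath M s1 (fin_trace ts) u" "(estep M)\<^sup>*\<^sup>* u s'"
    using Cons.IH[of s1] Cons.prems by auto
  show ?case
  proof (cases l)
    case None
    show ?thesis
    proof (cases "fin_trace ts")
      case Nil
      then show ?thesis
        using u t None by (auto intro: converse_rtranclp_into_rtranclp)
    next
      case (Cons a w)
      then show ?thesis
        using u t None by (auto simp: wstep_unfold[of M s])
    qed
  next
    case (Some a)
    then show ?thesis
      using u t by (auto simp: wstep_unfold[of M s])
  qed
qed simp

lemma esteps_fin_path:
  assumes "(estep M)\<^sup>*\<^sup>* s s'"
  shows "\<exists>ts. fin_path M s ts s' \<and> fin_trace ts = []"
  using assms
proof (induction rule: converse_rtranclp_induct)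
  case base
  show ?case by (intro exI[of _ "[]"]) simp
next
  case (step y z)
  then obtain ts where "fin_path M z ts s'" "fin_trace ts = []" by blast
  then show ?case
    using step(1) by (intro exI[of _ "(y, None, z) # ts"]) (simp add: outgoing_def)
qed

lemma wpath_fin_path:
  assumes "wpath M s w s'"
  shows "\<exists>ts. fin_path M s ts s' \<and> fin_trace ts = w"
  using assms
proof (induction w arbitrary: s)
  case Nil
  then show ?case by (intro exI[of _ "[]"]) simp
next
  case (Cons a w)
  then obtain v u where vu: "(estep M)\<^sup>*\<^sup>* s v" "(v, Some a, u) \<in> delta M" "wpath M u w s'"
    by (auto simp: wstep_def)
  obtain ts where ts: "fin_path M s ts v" "fin_trace ts = []"
    using esteps_fin_path[OF vu(1)] by blast
  obtain us where us: "fin_path M u us s'" "fin_trace us = w"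
    using Cons.IH[OF vu(3)] by blast
  show ?case
    using ts us vu(2)
    by (intro exI[of _ "ts @ (v, Some a, u) # us"]) (auto simp: fin_path_append outgoing_def)
qed

lemma lang_finI: "fin_path M (start M) ts s \<Longrightarrow> s \<in> finals M \<Longrightarrow> Fin (fin_trace ts) \<in> lang M"
  unfolding lang_def by blast

lemma lang_infI: "inf_run M r l \<Longrightarrow> inf_trace l \<in> lang M"
  unfolding lang_def by blast

section \<open>Infinite runs with a finite trace\<close>

lemma run_segment:
  assumes "\<forall>i. (r i, l i, r (Suc i)) \<in> delta M"
  shows "fin_path M (r 0) (map (\<lambda>i. (r i, l i, r (Suc i))) [0..<n]) (r n) \<and>
    fin_trace (map (\<lambda>i. (r i, l i, r (Suc i))) [0..<n]) =
      map (\<lambda>i. the (l i)) (filter (\<lambda>i. l i \<noteq> None) [0..<n])"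
proof (induction n)
  case (Suc n)
  then show ?case
    using assms[rule_format, of n] by (cases "l n") (auto simp: fin_path_append outgoing_def)
qed simp

lemma run_silent_segment:
  assumes "\<forall>i. (r i, l i, r (Suc i)) \<in> delta M" and "i \<le> j" and "\<forall>k. i \<le> k \<and> k < j \<longrightarrow> l k = None"
  shows "(estep M)\<^sup>*\<^sup>* (r i) (r j)"
  using assms(2,3)
proof (induction j rule: dec_induct)
  case (step j)
  then have "l j = None" by simp
  then have "estep M (r j) (r (Suc j))" using assms(1) by metis
  moreover have "(estep M)\<^sup>*\<^sup>* (r i) (r j)" using step by simp
  ultimately show ?case by (rule rtranclp.rtrancl_into_rtrancl[rotated])
qed simp

text \<open>Both lists are sorted, distinct and have the same elements. The filtered form is the one
  in which the trace of the first \<open>n\<close> transitions appears.\<close>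

lemma silent_tail:
  assumes "finite {i. l i \<noteq> None}"
  obtains n where "\<forall>i\<ge>n. l i = None"
    and "sorted_list_of_set {i. l i \<noteq> None} = filter (\<lambda>i. l i \<noteq> None) [0..<n]"
proof -
  obtain n where n: "\<forall>i\<in>{i. l i \<noteq> None}. i < n"
    using assms finite_nat_set_iff_bounded by blast
  then have "set (filter (\<lambda>i. l i \<noteq> None) [0..<n]) = {i. l i \<noteq> None}" by auto
  then have "sorted_list_of_set {i. l i \<noteq> None} = filter (\<lambda>i. l i \<noteq> None) [0..<n]"
    using assms by (intro sorted_distinct_set_unique) (auto intro: sorted_wrt_filter)
  moreover have "\<forall>i\<ge>n. l i = None" using n by fastforce
  ultimately show ?thesis using that by blast
qed

text \<open>The run is cut at a point after its last visible label: the part before gives the word,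
  the part after is a divergence.\<close>

lemma inf_trace_finite:
  assumes "inf_run M r l" and "finite {i. l i \<noteq> None}"
  shows "\<exists>w u. inf_trace l = Fin w \<and> wpath M (start M) w u \<and> terminates M u"
proof -
  have run: "r 0 = start M" "\<forall>i. (r i, l i, r (Suc i)) \<in> delta M"
    using assms(1) by (auto simp: inf_run_def)
  obtain n where n: "\<forall>i\<ge>n. l i = None"
    and sl: "sorted_list_of_set {i. l i \<noteq> None} = filter (\<lambda>i. l i \<noteq> None) [0..<n]"
    using silent_tail[OF assms(2)] by blast
  define w where "w = map (\<lambda>i. the (l i)) (filter (\<lambda>i. l i \<noteq> None) [0..<n])"
  have tr: "inf_trace l = Fin w"
    using assms(2) sl by (simp add: inf_trace_def w_def)
  note seg = run_segment[OF run(2), of n]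
  obtain u where u: "wpath M (start M) w u" "(estep M)\<^sup>*\<^sup>* u (r n)"
    using fin_path_wpath[OF conjunct1[OF seg]] unfolding conjunct2[OF seg] run(1) w_def by blast
  have "diverges M (r n)"
    unfolding diverges_def
  proof (intro exI[of _ "\<lambda>i. r (n + i)"] conjI allI)
    fix i
    show "estep M (r (n + i)) (r (n + Suc i))"
      using run(2)[rule_format, of "n + i"] n by simp
  qed simp
  then have "terminates M u" using u(2) unfolding terminates_def by blast
  with tr u(1) show ?thesis by blast
qed

text \<open>The divergence supplies a run with silent labels only, and the transitions of
  \<open>ts\<close> are put in front of it one at a time by \<open>case_nat\<close>. The last
  conjunct keeps track of the trace.\<close>

lemma diverging_run_exists:
  assumes "fin_path M s ts u" and "diverges M u"
  shows "\<exists>r l. r 0 = s \<and> (\<forall>i. (r i, l i, r (Suc i)) \<in> delta M) \<and> (\<forall>i\<ge>length ts. l i = None) \<and>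
    ts = map (\<lambda>i. (r i, l i, r (Suc i))) [0..<length ts]"
  using assms(1)
proof (induction ts arbitrary: s)
  case Nil
  then obtain g where "g 0 = s" "\<forall>i. estep M (g i) (g (Suc i))"
    using assms(2) unfolding diverges_def by auto
  then show ?case by (intro exI[of _ g] exI[of _ "\<lambda>_. None"]) simp
next
  case (Cons t ts)
  then obtain a s1 where t: "t = (s, a, s1)" "(s, a, s1) \<in> delta M" "fin_path M s1 ts u"
    by (cases t) (auto simp: outgoing_def)
  obtain r l where rl: "r 0 = s1" "\<forall>i. (r i, l i, r (Suc i)) \<in> delta M"
    "\<forall>i\<ge>length ts. l i = None" "ts = map (\<lambda>i. (r i, l i, r (Suc i))) [0..<length ts]"
    using Cons.IH[OF t(3)] by blast
  have "\<forall>i. (case_nat s r i, case_nat a l i, case_nat s r (Suc i)) \<in> delta M"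
    using rl(1,2) t(2) by (simp split: nat.split)
  moreover have "\<forall>i\<ge>length (t # ts). case_nat a l i = None"
    using rl(3) by (simp split: nat.split)
  moreover have "t # ts = map (\<lambda>i. (case_nat s r i, case_nat a l i, case_nat s r (Suc i))) [0..<length (t # ts)]"
    unfolding length_Cons map_upt_Suc by (simp add: rl(1) t(1) flip: rl(4))
  ultimately show ?case
    by (intro exI[of _ "case_nat s r"] exI[of _ "case_nat a l"]) simp
qed

lemma diverging_run:
  assumes "fin_path M (start M) ts u" and "diverges M u"
  shows "Fin (fin_trace ts) \<in> lang M"
proof -
  obtain r l where rl: "r 0 = start M" "\<forall>i. (r i, l i, r (Suc i)) \<in> delta M"
    "\<forall>i\<ge>length ts. l i = None" "ts = map (\<lambda>i. (r i, l i, r (Suc i))) [0..<length ts]"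
    using diverging_run_exists[OF assms] by blast
  have run: "inf_run M r l" using rl(1,2) by (simp add: inf_run_def)
  have sub: "{i. l i \<noteq> None} \<subseteq> {..<length ts}"
  proof
    fix i assume "i \<in> {i. l i \<noteq> None}"
    then have "\<not> length ts \<le> i" using rl(3) by auto
    then show "i \<in> {..<length ts}" by simp
  qed
  then have fin: "finite {i. l i \<noteq> None}" using finite_subset by blast
  have "fin_trace ts = map (\<lambda>i. the (l i)) (filter (\<lambda>i. l i \<noteq> None) [0..<length ts])"
    using run_segment[OF rl(2), of "length ts"] unfolding rl(4)[symmetric] by simp
  also have "filter (\<lambda>i. l i \<noteq> None) [0..<length ts] = sorted_list_of_set {i. l i \<noteq> None}"
    using fin sub by (intro sorted_distinct_set_unique) (auto intro: sorted_wrt_filter)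
  finally have "inf_trace l = Fin (fin_trace ts)"
    using fin by (simp add: inf_trace_def)
  then show ?thesis using lang_infI[OF run] by simp
qed

lemma lang_Fin: "Fin w \<in> lang M \<longleftrightarrow> (\<exists>u. wpath M (start M) w u \<and> terminates M u)"
proof
  assume "Fin w \<in> lang M"
  then consider ts s where "w = fin_trace ts" "fin_path M (start M) ts s" "s \<in> finals M"
    | r l where "Fin w = inf_trace l" "inf_run M r l"
    unfolding lang_def by auto
  then show "\<exists>u. wpath M (start M) w u \<and> terminates M u"
  proof cases
    case 1
    then show ?thesis using fin_path_wpath[OF 1(2)] unfolding terminates_def by blast
  next
    case 2
    then have "finite {i. l i \<noteq> None}"
      by (auto simp: inf_trace_def Let_def split: if_splits)
    then show ?thesis using inf_trace_finite[OF 2(2)] 2(1) by auto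
  qed
next
  assume "\<exists>u. wpath M (start M) w u \<and> terminates M u"
  then obtain u v where u: "wpath M (start M) w u" "(estep M)\<^sup>*\<^sup>* u v" "v \<in> finals M \<or> diverges M v"
    unfolding terminates_def by blast
  then obtain ts us where "fin_path M (start M) ts u" "fin_trace ts = w"
    "fin_path M u us v" "fin_trace us = []"
    using wpath_fin_path esteps_fin_path by metis
  then have path: "fin_path M (start M) (ts @ us) v" "fin_trace (ts @ us) = w"
    by (auto simp: fin_path_append)
  show "Fin w \<in> lang M"
  proof (cases "v \<in> finals M")
    case True
    then show ?thesis using lang_finI[OF path(1)] path(2) by simp
  next
    case False
    then show ?thesis using diverging_run[OF path(1)] path(2) u(3) by simp
  qed
qed

section \<open>Infinite words and the positions of visible labels\<close>

lemma enumerate_0_le: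
  fixes I :: "nat set"
  shows "k \<in> I \<Longrightarrow> enumerate I 0 \<le> k"
  unfolding enumerate_0 by (rule Least_le)

lemma enumerate_Suc_le:
  fixes I :: "nat set"
  assumes "infinite I" and "k \<in> I" and "enumerate I n < k"
  shows "enumerate I (Suc n) \<le> k"
  unfolding enumerate_Suc''[OF assms(1)] by (rule Least_le) (simp add: assms)

lemma enumerate_gap:
  fixes I :: "nat set"
  assumes "infinite I"
  shows "k < enumerate I 0 \<Longrightarrow> k \<notin> I"
    and "enumerate I n < k \<Longrightarrow> k < enumerate I (Suc n) \<Longrightarrow> k \<notin> I"
  using enumerate_0_le[of k I] enumerate_Suc_le[OF assms, of k n] by linarith+

definition inf_wpath :: "('s, 'a) fsm \<Rightarrow> 's \<Rightarrow> (nat \<Rightarrow> 'a) \<Rightarrow> bool" where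
  "inf_wpath M s f \<longleftrightarrow> (\<exists>g. g 0 = s \<and> (\<forall>i. wstep M (g i) (f i) (g (Suc i))))"

lemma inf_trace_infinite:
  assumes "inf_run M r l" and inf: "infinite {i. l i \<noteq> None}"
  shows "inf_wpath M (start M) (\<lambda>n. the (l (enumerate {i. l i \<noteq> None} n)))"
proof -
  have run: "r 0 = start M" "\<forall>i. (r i, l i, r (Suc i)) \<in> delta M"
    using assms(1) by (auto simp: inf_run_def)
  define e where "e = enumerate {i. l i \<noteq> None}"
  have e: "(r (e n), Some (the (l (e n))), r (Suc (e n))) \<in> delta M" for n
    using enumerate_in_set[OF inf, of n] run(2) by (metis (mono_tags, lifting) e_def mem_Collect_eq option.collapse)
  \<comment> \<open>\<open>g n\<close> is the state entered by the visible transition before the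
    \<open>n\<close>-th one, counted from 0, or the start if \<open>n = 0\<close>. From there to
    position \<open>e n\<close> all transitions are silent.\<close>
  define g where "g = case_nat (r 0) (\<lambda>n. r (Suc (e n)))"
  have gap0: "l k = None" if "k < e 0" for k
    using enumerate_gap(1)[OF inf, of k] that by (simp add: e_def)
  have gapS: "l k = None" if "e n < k" "k < e (Suc n)" for n k
    using enumerate_gap(2)[OF inf, of n k] that by (simp add: e_def)
  have esteps: "(estep M)\<^sup>*\<^sup>* (g n) (r (e n))" for n
  proof (cases n)
    case 0
    have "(estep M)\<^sup>*\<^sup>* (r 0) (r (e 0))"
      by (rule run_silent_segment[OF run(2)]) (simp_all add: gap0)
    then show ?thesis by (simp add: 0 g_def)
  next
    case (Suc k)
    have "e k < e (Suc k)" unfolding e_def using inf by (simp add: enumerate_step)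
    then have "(estep M)\<^sup>*\<^sup>* (r (Suc (e k))) (r (e (Suc k)))"
      using gapS[of k] by (intro run_silent_segment[OF run(2)]) (simp_all add: Suc_le_eq)
    then show ?thesis by (simp add: Suc g_def)
  qed
  have "wstep M (g n) (the (l (e n))) (g (Suc n))" for n
    unfolding wstep_def
    using esteps[of n] e[of n] by (intro exI[of _ "r (e n)"]) (simp add: g_def)
  moreover have "g 0 = start M" using run(1) by (simp add: g_def)
  ultimately show ?thesis unfolding inf_wpath_def e_def by (intro exI[of _ g]) simp
qed

text \<open>A configuration \<open>(n, j)\<close> says that \<open>j\<close> of the \<open>K n\<close> silent transitions before the \<open>n\<close>-th
  letter have been taken.\<close>

lemma inf_wpath_run:
  assumes "inf_wpath M (start M) f"
  shows "Inf f \<in> lang M"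
proof -
  obtain g where g: "g 0 = start M" "\<And>i. wstep M (g i) (f i) (g (Suc i))"
    using assms unfolding inf_wpath_def by blast
  have "\<exists>k p. p 0 = g n \<and> (\<forall>j<k. estep M (p j) (p (Suc j))) \<and> (p k, Some (f n), g (Suc n)) \<in> delta M" for n
  proof -
    obtain u k where "((estep M) ^^ k) (g n) u" "(u, Some (f n), g (Suc n)) \<in> delta M"
      using g(2)[of n] unfolding wstep_def rtranclp_power by blast
    then show ?thesis by (auto simp: relpowp_fun_conv)
  qed
  then obtain K P where KP: "\<And>n. P n 0 = g n" "\<And>n j. j < K n \<Longrightarrow> estep M (P n j) (P n (Suc j))"
    "\<And>n. (P n (K n), Some (f n), g (Suc n)) \<in> delta M"
    by metis
  define nxt where "nxt = (\<lambda>(n, j). if j < K n then (n, Suc j) else (Suc n, 0))"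
  define c where "c i = (nxt ^^ i) (0, 0)" for i
  have c0: "c 0 = (0, 0)" by (simp add: c_def)
  have cS: "c (Suc i) = nxt (c i)" for i by (simp add: c_def)
  define r where "r i = P (fst (c i)) (snd (c i))" for i
  define l where "l i = (if snd (c i) < K (fst (c i)) then None else Some (f (fst (c i))))" for i
  define I where "I = {i. l i \<noteq> None}"
  have le: "snd (c i) \<le> K (fst (c i))" for i
    by (induction i) (auto simp: c0 cS nxt_def split: prod.split)
  have "(r i, l i, r (Suc i)) \<in> delta M" for i
  proof (cases "snd (c i) < K (fst (c i))")
    case True
    then show ?thesis using KP(2) by (auto simp: r_def l_def cS nxt_def split_beta)
  next
    case False
    then have "snd (c i) = K (fst (c i))" using le[of i] by simp
    then show ?thesis using KP(1,3) by (simp add: r_def l_def cS nxt_def split_beta)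
  qed
  then have run: "inf_run M r l" using g(1) KP(1) by (simp add: inf_run_def r_def c0)
  \<comment> \<open>The number of silent transitions left before the next letter decreases with each
    silent step, so a visible label must come.\<close>
  have hit: "\<exists>j\<ge>i. j \<in> I" for i
  proof (induction "K (fst (c i)) - snd (c i)" arbitrary: i rule: less_induct)
    case less
    show ?case
    proof (cases "i \<in> I")
      case False
      then have lt: "snd (c i) < K (fst (c i))" by (simp add: I_def l_def split: if_splits)
      then have "c (Suc i) = (fst (c i), Suc (snd (c i)))" by (simp add: cS nxt_def split_beta)
      then have "\<exists>j\<ge>Suc i. j \<in> I" using less[of "Suc i"] lt by simp
      then show ?thesis by (meson Suc_leD)
    qed blast
  qed
  then have inf: "infinite I" by (auto simp: infinite_nat_iff_unbounded_le)
  have out: "fst (c (Suc i)) = fst (c i)" if "i \<notin> I" for i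
    using that by (simp add: I_def l_def cS nxt_def split_beta split: if_splits)
  have into: "fst (c (Suc i)) = Suc (fst (c i))" "the (l i) = f (fst (c i))" if "i \<in> I" for i
    using that by (simp_all add: I_def l_def cS nxt_def split_beta split: if_splits)
  have const: "fst (c j) = fst (c i)" if "i \<le> j" "\<And>k. i \<le> k \<Longrightarrow> k < j \<Longrightarrow> k \<notin> I" for i j
    using that by (induction j rule: dec_induct) (simp_all add: out)
  have mem: "enumerate I n \<in> I" for n using inf by (rule enumerate_in_set)
  \<comment> \<open>The first component of a configuration counts the letters already emitted: it is
    constant over silent positions and grows by one at visible ones.\<close>
  have idx: "fst (c (enumerate I n)) = n" for n
  proof (induction n)
    case 0
    have "fst (c (enumerate I 0)) = fst (c 0)"
      using enumerate_gap(1)[OF inf] by (intro const) blast+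
    then show ?case by (simp add: c0)
  next
    case (Suc n)
    have lt: "enumerate I n < enumerate I (Suc n)" using inf by (rule enumerate_step)
    have "fst (c (enumerate I (Suc n))) = fst (c (Suc (enumerate I n)))"
    proof (rule const)
      show "Suc (enumerate I n) \<le> enumerate I (Suc n)" using lt by (rule Suc_leI)
      show "k \<notin> I" if "Suc (enumerate I n) \<le> k" "k < enumerate I (Suc n)" for k
        using enumerate_gap(2)[OF inf Suc_le_lessD[OF that(1)] that(2)] .
    qed
    then show ?case using Suc into(1)[OF mem, of n] by simp
  qed
  have "the (l (enumerate I n)) = f n" for n
    using into(2)[OF mem, of n] idx[of n] by simp
  then have "inf_trace l = Inf f"
    using inf by (simp add: inf_trace_def I_def Let_def)
  then show ?thesis using lang_infI[OF run] by simp
qed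

lemma lang_Inf: "Inf f \<in> lang M \<longleftrightarrow> inf_wpath M (start M) f"
proof
  assume "Inf f \<in> lang M"
  then obtain r l where rl: "Inf f = inf_trace l" "inf_run M r l"
    unfolding lang_def by auto
  then have "infinite {i. l i \<noteq> None}"
    and "f = (\<lambda>n. the (l (enumerate {i. l i \<noteq> None} n)))"
    by (auto simp: inf_trace_def Let_def split: if_splits)
  then show "inf_wpath M (start M) f" using inf_trace_infinite[OF rl(2)] by simp
qed (rule inf_wpath_run)

section \<open>Machines that alternate sends and receives\<close>

type_synonym ('p, 'v) interaction = "'p \<times> 'p \<times> 'v"

fun snd_of :: "('p, 'v) interaction \<Rightarrow> ('p, 'v) event" where
  "snd_of (p, q, m) = Snd p q m"

fun rcv_of :: "('p, 'v) interaction \<Rightarrow> ('p, 'v) event" where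
  "rcv_of (p, q, m) = Rcv p q m"

definition pair_word :: "('p, 'v) interaction list \<Rightarrow> ('p, 'v) event list" where
  "pair_word cs = concat (map (\<lambda>c. [snd_of c, rcv_of c]) cs)"

lemma pair_word_simps [simp]:
  "pair_word [] = []"
  "pair_word (c # cs) = snd_of c # rcv_of c # pair_word cs"
  "pair_word (cs @ ds) = pair_word cs @ pair_word ds"
  by (simp_all add: pair_word_def)

definition pstep :: "('s, ('p, 'v) event) fsm \<Rightarrow> 's \<Rightarrow> ('p, 'v) interaction \<Rightarrow> 's \<Rightarrow> bool" where
  "pstep M s c s' \<longleftrightarrow> (\<exists>t. wstep M s (snd_of c) t \<and> wstep M t (rcv_of c) s')"

text \<open>\<open>Z\<close> is meant for states with all channels empty, \<open>Q c\<close> for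
  states in which the message of \<open>c\<close> is in transit; no finite word may end in the
  latter. The sets are parameters so that they can be reachable states for the given machine and
  states over positions for the global type.\<close>

definition alternating ::
  "('s, ('p, 'v) event) fsm \<Rightarrow> 's set \<Rightarrow> (('p, 'v) interaction \<Rightarrow> 's set) \<Rightarrow> bool" where
  "alternating M Z Q \<longleftrightarrow> start M \<in> Z \<and>
     (\<forall>s\<in>Z. \<forall>a s'. wstep M s a s' \<longrightarrow> (\<exists>c. a = snd_of c \<and> s' \<in> Q c)) \<and>
     (\<forall>c. \<forall>t\<in>Q c. \<not> terminates M t \<and> (\<forall>a s'. wstep M t a s' \<longrightarrow> a = rcv_of c \<and> s' \<in> Z))"

lemma alternating_sndD:
  "alternating M Z Q \<Longrightarrow> s \<in> Z \<Longrightarrow> wstep M s a s' \<Longrightarrow> \<exists>c. a = snd_of c \<and> s' \<in> Q c"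
  unfolding alternating_def by blast

lemma alternating_rcvD:
  assumes "alternating M Z Q" "t \<in> Q c"
  shows "\<not> terminates M t" and "wstep M t a s' \<Longrightarrow> a = rcv_of c" and "wstep M t a s' \<Longrightarrow> s' \<in> Z"
  using assms unfolding alternating_def by blast+

text \<open>The states between a send and its receive stay unrelated. The global type settles the
  outcome of a receive already at the send, so it may be unable to simulate a machine with
  nondeterministic receives event by event.\<close>

definition simulates ::
  "('s \<Rightarrow> 't \<Rightarrow> bool) \<Rightarrow> ('s, ('p, 'v) event) fsm \<Rightarrow> ('t, ('p, 'v) event) fsm \<Rightarrow> bool" where
  "simulates R M N \<longleftrightarrow> R (start M) (start N) \<and>
     (\<forall>s t. R s t \<longrightarrow> (terminates M s \<longrightarrow> terminates N t) \<and>
       (\<forall>c s'. pstep M s c s' \<longrightarrow> (\<exists>t'. pstep N t c t' \<and> R s' t')))"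

lemma simulatesD:
  assumes "simulates R M N" "R s t"
  shows "terminates M s \<Longrightarrow> terminates N t"
    and "pstep M s c s' \<Longrightarrow> \<exists>t'. pstep N t c t' \<and> R s' t'"
  using assms unfolding simulates_def by blast+

lemma simulates_wpath:
  assumes alt: "alternating M Z Q" and sim: "simulates R M N"
    and "wpath M s w u" and "terminates M u" and "s \<in> Z" and "R s t"
  shows "\<exists>v. wpath N t w v \<and> terminates N v"
  using assms(3,5,6)
proof (induction w arbitrary: s t rule: length_induct)
  case (1 w)
  show ?case
  proof (cases w)
    case Nil
    then show ?thesis
      using 1 simulatesD(1)[OF sim \<open>R s t\<close>] assms(4) by (intro exI[of _ t]) simp
  next
    case (Cons a w1)
    then obtain s1 where s1: "wstep M s a s1" "wpath M s1 w1 u" using 1 by auto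
    then obtain c where c: "a = snd_of c" "s1 \<in> Q c"
      using alternating_sndD[OF alt \<open>s \<in> Z\<close>] by blast
    \<comment> \<open>Letters are consumed in pairs: a word cannot stop after a send, since states
      of \<open>Q c\<close> do not terminate.\<close>
    have "w1 \<noteq> []" using s1(2) alternating_rcvD(1)[OF alt c(2)] assms(4) by auto
    then obtain b w2 where w1: "w1 = b # w2" by (cases w1) auto
    then obtain s2 where s2: "wstep M s1 b s2" "wpath M s2 w2 u" using s1 by auto
    then have b: "b = rcv_of c" "s2 \<in> Z" using alternating_rcvD[OF alt c(2)] by blast+
    have "pstep M s c s2" using s1(1) s2(1) b c unfolding pstep_def by blast
    then obtain t2 where t2: "pstep N t c t2" "R s2 t2"
      using simulatesD(2)[OF sim \<open>R s t\<close>] by blast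
    then obtain v where "wpath N t2 w2 v" "terminates N v"
      using 1(1)[rule_format, of w2] s2(2) b(2) by (auto simp: Cons w1)
    moreover obtain t1 where "wstep N t a t1" "wstep N t1 b t2"
      using t2(1) c b unfolding pstep_def by blast
    ultimately show ?thesis by (auto simp: Cons w1)
  qed
qed

lemma simulates_inf_wpath:
  assumes alt: "alternating M Z Q" and sim: "simulates R M N"
    and "inf_wpath M s f" and "s \<in> Z" and "R s t"
  shows "inf_wpath N t f"
proof -
  obtain g where g: "g 0 = s" "\<And>i. wstep M (g i) (f i) (g (Suc i))"
    using assms(3) unfolding inf_wpath_def by blast
  have even: "g (2 * n) \<in> Z" for n
  proof (induction n)
    case 0
    then show ?case using g(1) \<open>s \<in> Z\<close> by simp
  next
    case (Suc n)
    obtain c where "g (Suc (2 * n)) \<in> Q c"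
      using alternating_sndD[OF alt Suc g(2)] by blast
    from alternating_rcvD(3)[OF alt this g(2)] show ?case by simp
  qed
  have "\<exists>c. f (2 * n) = snd_of c \<and> f (Suc (2 * n)) = rcv_of c \<and>
      pstep M (g (2 * n)) c (g (2 * Suc n))" for n
  proof -
    obtain c where c: "f (2 * n) = snd_of c" "g (Suc (2 * n)) \<in> Q c"
      using alternating_sndD[OF alt even g(2)] by blast
    have "f (Suc (2 * n)) = rcv_of c" by (rule alternating_rcvD(2)[OF alt c(2) g(2)])
    moreover have "pstep M (g (2 * n)) c (g (2 * Suc n))"
      unfolding pstep_def using c(1) calculation g(2)[of "2 * n"] g(2)[of "Suc (2 * n)"] by auto
    ultimately show ?thesis using c(1) by blast
  qed
  then obtain c where c: "\<And>n. f (2 * n) = snd_of (c n)" "\<And>n. f (Suc (2 * n)) = rcv_of (c n)"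
    "\<And>n. pstep M (g (2 * n)) (c n) (g (2 * Suc n))"
    by metis
  \<comment> \<open>Only the states at even positions are simulated. The conjunct on
    \<open>n = 0\<close> makes the chosen sequence start at \<open>t\<close>.\<close>
  have "\<exists>h. \<forall>n. (R (g (2 * n)) (h n) \<and> (n = 0 \<longrightarrow> h n = t)) \<and> pstep N (h n) (c n) (h (Suc n))"
  proof (rule dependent_nat_choice)
    show "\<exists>y. R (g (2 * 0)) y \<and> (0 = (0::nat) \<longrightarrow> y = t)" using g(1) \<open>R s t\<close> by simp
    show "\<exists>z. (R (g (2 * Suc n)) z \<and> (Suc n = 0 \<longrightarrow> z = t)) \<and> pstep N y (c n) z"
      if "R (g (2 * n)) y \<and> (n = 0 \<longrightarrow> y = t)" for y n
      using simulatesD(2)[OF sim _ c(3)] that by blast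
  qed
  then obtain h where h: "h 0 = t" "\<And>n. pstep N (h n) (c n) (h (Suc n))" by blast
  \<comment> \<open>The intermediate states of \<open>N\<close> are arbitrary witnesses of its
    interactions, without relation to the odd states of \<open>g\<close>.\<close>
  obtain k where k: "\<And>n. wstep N (h n) (snd_of (c n)) (k n)" "\<And>n. wstep N (k n) (rcv_of (c n)) (h (Suc n))"
    using h(2) unfolding pstep_def by metis
  define g' where "g' i = (if even i then h (i div 2) else k (i div 2))" for i
  have "wstep N (g' i) (f i) (g' (Suc i))" for i
  proof (cases "even i")
    case True
    then obtain n where "i = 2 * n" by blast
    then show ?thesis using k(1)[of n] c(1)[of n] by (simp add: g'_def)
  next
    case False
    then obtain n where "i = Suc (2 * n)" using oddE by fastforce
    then show ?thesis using k(2)[of n] c(2)[of n] by (simp add: g'_def)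
  qed
  moreover have "g' 0 = t" using h(1) by (simp add: g'_def)
  ultimately show ?thesis unfolding inf_wpath_def by (intro exI[of _ g']) simp
qed

lemma simulates_lang:
  assumes alt: "alternating M Z Q" and sim: "simulates R M N"
  shows "lang M \<subseteq> lang N"
proof
  fix W assume W: "W \<in> lang M"
  have 0: "start M \<in> Z" "R (start M) (start N)"
    using assms unfolding alternating_def simulates_def by blast+
  show "W \<in> lang N"
  proof (cases W)
    case (Fin w)
    then show ?thesis
      using W simulates_wpath[OF alt sim _ _ 0, of w] unfolding Fin lang_Fin by blast
  next
    case (Inf f)
    then show ?thesis
      using W simulates_inf_wpath[OF alt sim _ 0, of f] unfolding Inf lang_Inf by blast
  qed
qed


section \<open>Sum-1-bounded machines alternate\<close>

lemma esteps_states: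
  assumes "is_fsm A M" and "(estep M)\<^sup>*\<^sup>* s s'" and "s \<in> states M"
  shows "s' \<in> states M"
  using assms(2,3) by (induction rule: rtranclp_induct) (use assms(1) in \<open>auto simp: is_fsm_def\<close>)

lemma wstep_states: "is_fsm A M \<Longrightarrow> wstep M s a s' \<Longrightarrow> s' \<in> states M"
  by (auto simp: wstep_def is_fsm_def)

lemma wstep_label: "is_fsm A M \<Longrightarrow> wstep M s a s' \<Longrightarrow> a \<in> A"
  by (auto simp: wstep_def is_fsm_def)

lemma wpath_states: "is_fsm A M \<Longrightarrow> s \<in> states M \<Longrightarrow> wpath M s w s' \<Longrightarrow> s' \<in> states M"
  by (induction w arbitrary: s) (auto dest: wstep_states)

text \<open>If no letter could follow, every state reached silently would be non-final, hence by
  sink-finality have an exit, which would again be silent. The silent steps would go on for ever,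
  and the state would diverge after all.\<close>

lemma progress:
  assumes fsm: "is_fsm A M" and sink: "sink_final M" and s: "s \<in> states M"
    and nt: "\<not> terminates M s"
  shows "\<exists>a s'. wstep M s a s'"
proof (rule ccontr)
  assume stuck: "\<nexists>a s'. wstep M s a s'"
  have "\<exists>g. \<forall>n. ((estep M)\<^sup>*\<^sup>* s (g n) \<and> (n = 0 \<longrightarrow> g n = s)) \<and> estep M (g n) (g (Suc n))"
  proof (rule dependent_nat_choice)
    show "\<exists>x. (estep M)\<^sup>*\<^sup>* s x \<and> (0 = (0::nat) \<longrightarrow> x = s)" by blast
  next
    fix x and n :: nat
    assume "(estep M)\<^sup>*\<^sup>* s x \<and> (n = 0 \<longrightarrow> x = s)"
    then have x: "(estep M)\<^sup>*\<^sup>* s x" "x \<in> states M" using esteps_states[OF fsm _ s] by auto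
    then have "x \<notin> finals M" using nt unfolding terminates_def by blast
    then obtain a y where y: "(x, a, y) \<in> delta M"
      using sink x(2) unfolding sink_final_def outgoing_def by fastforce
    then have "a = None" using stuck x(1) unfolding wstep_def by (cases a) auto
    then show "\<exists>y. ((estep M)\<^sup>*\<^sup>* s y \<and> (Suc n = 0 \<longrightarrow> y = s)) \<and> estep M x y"
      using x(1) y by (auto intro: rtranclp.rtrancl_into_rtrancl)
  qed
  then have "diverges M s" unfolding diverges_def by blast
  then show False using nt unfolding terminates_def by blast
qed

lemma inf_wpath_prepend:
  assumes "wpath M s w u" and "inf_wpath M u f"
  shows "\<exists>f'. inf_wpath M s f' \<and> map f' [0..<length w] = w"
  using assms(1)
proof (induction w arbitrary: s)
  case Nil
  then show ?case using assms(2) by auto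
next
  case (Cons a w)
  then obtain s1 where s1: "wstep M s a s1" "wpath M s1 w u" by auto
  then obtain f' where f': "inf_wpath M s1 f'" "map f' [0..<length w] = w"
    using Cons.IH by blast
  then obtain g where g: "g 0 = s1" "\<And>i. wstep M (g i) (f' i) (g (Suc i))"
    unfolding inf_wpath_def by blast
  have "\<forall>i. wstep M (case_nat s g i) (case_nat a f' i) (case_nat s g (Suc i))"
    using g s1(1) by (simp split: nat.split)
  then have "inf_wpath M s (case_nat a f')"
    unfolding inf_wpath_def by (intro exI[of _ "case_nat s g"]) simp
  moreover have "map (case_nat a f') [0..<length (a # w)] = a # w"
    unfolding length_Cons map_upt_Suc by (simp add: f'(2))
  ultimately show ?case by (intro exI[of _ "case_nat a f'"] conjI)
qed

text \<open>Either some continuation terminates, or no state reachable from \<open>s\<close> does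
  and \<open>progress\<close> supplies letters for ever. Conditions on the finite prefixes of words
  of the language thereby hold for every path from the start.\<close>

lemma wpath_extends:
  assumes fsm: "is_fsm A M" and sink: "sink_final M" and path: "wpath M (start M) w s"
  shows "\<exists>W\<in>lang M. w \<in> fin_prefixes W"
proof (cases "\<exists>v u. wpath M s v u \<and> terminates M u")
  case True
  then obtain v where "Fin (w @ v) \<in> lang M"
    using path unfolding lang_Fin wpath_append by blast
  then show ?thesis by (intro bexI[of _ "Fin (w @ v)"]) auto
next
  case False
  have s: "s \<in> states M"
    using wpath_states[OF fsm _ path] fsm by (simp add: is_fsm_def)
  have "\<exists>g. \<forall>n. ((\<exists>v. wpath M s v (g n)) \<and> (n = 0 \<longrightarrow> g n = s)) \<and> (\<exists>a. wstep M (g n) a (g (Suc n)))"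
  proof (rule dependent_nat_choice)
    show "\<exists>x. (\<exists>v. wpath M s v x) \<and> (0 = (0::nat) \<longrightarrow> x = s)" by (metis wpath.simps(1))
  next
    fix x and n :: nat
    assume "(\<exists>v. wpath M s v x) \<and> (n = 0 \<longrightarrow> x = s)"
    then obtain v where v: "wpath M s v x" by blast
    then have "\<not> terminates M x" "x \<in> states M" using False wpath_states[OF fsm s] by blast+
    then obtain a y where y: "wstep M x a y" using progress[OF fsm sink] by blast
    then have "wpath M s (v @ [a]) y" using v by (auto simp: wpath_append)
    then show "\<exists>y. ((\<exists>v. wpath M s v y) \<and> (Suc n = 0 \<longrightarrow> y = s)) \<and> (\<exists>a. wstep M x a y)"
      using y by blast
  qed
  then obtain g where g: "g 0 = s" "\<And>n. \<exists>a. wstep M (g n) a (g (Suc n))" by blast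
  then obtain f where "\<And>n. wstep M (g n) (f n) (g (Suc n))" by metis
  then have "inf_wpath M s f" using g(1) unfolding inf_wpath_def by blast
  then obtain f' where "inf_wpath M (start M) f'" "map f' [0..<length w] = w"
    using inf_wpath_prepend[OF path] by blast
  then show ?thesis
    by (intro bexI[of _ "Inf f'"]) (auto simp: lang_Inf image_iff intro!: exI[of _ "length w"])
qed

section \<open>Messages in transit\<close>

lemma snds_simps [simp]:
  "snds p q [] = []"
  "snds p q (e # w) = (if is_Snd e \<and> sender e = p \<and> receiver e = q then [e] else []) @ snds p q w"
  "snds p q (v @ w) = snds p q v @ snds p q w"
  by (simp_all add: snds_def)

lemma rcvs_simps [simp]:
  "rcvs p q [] = []"
  "rcvs p q (e # w) = (if is_Rcv e \<and> sender e = p \<and> receiver e = q then [e] else []) @ rcvs p q w"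
  "rcvs p q (v @ w) = rcvs p q v @ rcvs p q w"
  by (simp_all add: rcvs_def)

lemma msgs_simps [simp]:
  "msgs [] = []" "msgs (e # w) = msg e # msgs w" "msgs (v @ w) = msgs v @ msgs w"
  by (simp_all add: msgs_def)

lemma msgs_pair_word: "msgs (rcvs p q (pair_word cs)) = msgs (snds p q (pair_word cs))"
  by (induction cs) auto

lemma in_flight_append: "in_flight p q (v @ w) = in_flight p q v + in_flight p q w"
  by (simp add: in_flight_def)

lemma in_flight_pair_word: "in_flight p q (pair_word cs) = 0"
  using arg_cong[OF msgs_pair_word[of p q cs], of length] by (simp add: in_flight_def msgs_def)

text \<open>Distinctness of \<open>p\<close> and \<open>q\<close> puts their channel among those
  over which the sum ranges.\<close>

lemma sum_in_flight_Snd: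
  fixes p q :: "'p::finite"
  assumes "p \<noteq> q"
  shows "(\<Sum>(r, s)\<in>{(r, s). r \<noteq> s}. in_flight r s [Snd p q m]) = 1"
proof -
  have "(\<Sum>(r, s)\<in>{(r, s). r \<noteq> s}. in_flight r s [Snd p q m]) =
      (\<Sum>x\<in>{(r, s). r \<noteq> s}. if x = (p, q) then 1 else 0)"
    by (rule sum.cong) (auto simp: in_flight_def split: if_splits)
  also have "\<dots> = 1" using assms by (simp add: sum.delta)
  finally show ?thesis .
qed

text \<open>Complete pairs leave every channel empty, so a receive would make the received sequence
  longer than the sent one.\<close>

lemma compliant_after_pairs:
  assumes "prefix (msgs (rcvs (sender a) (receiver a) (pair_word cs @ [a])))
    (msgs (snds (sender a) (receiver a) (pair_word cs @ [a])))"
  shows "\<exists>c. a = snd_of c"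
proof (cases a)
  case (Snd p q m)
  then have "a = snd_of (p, q, m)" by simp
  then show ?thesis ..
next
  case (Rcv p q m)
  then show ?thesis using assms prefix_length_le[OF assms] by (simp add: msgs_pair_word)
qed

text \<open>Exactly one message is in transit. Another send would bring the sum to 2, a receive from
  another channel would find it empty, and a receive from the same channel must deliver the message
  just sent, by the prefix condition.\<close>

lemma compliant_after_send:
  fixes c :: "('p::finite, 'v) interaction"
  assumes "prefix (msgs (rcvs (sender a) (receiver a) (pair_word cs @ [snd_of c, a])))
    (msgs (snds (sender a) (receiver a) (pair_word cs @ [snd_of c, a])))"
    and "(\<Sum>(p, q)\<in>{(p, q). p \<noteq> q}. in_flight p q (pair_word cs @ [snd_of c, a])) \<le> 1"
    and "snd_of c \<in> Sigma_ev" and "a \<in> Sigma_ev"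
  shows "a = rcv_of c"
proof -
  obtain p q m where c: "c = (p, q, m)" by (cases c)
  show ?thesis
  proof (cases a)
    case (Snd p' q' m')
    have "in_flight r s (pair_word cs @ [snd_of c, a]) =
        in_flight r s [Snd p q m] + in_flight r s [Snd p' q' m']" for r s
      using in_flight_append[of r s "[Snd p q m]" "[Snd p' q' m']"]
      by (simp add: in_flight_append in_flight_pair_word c Snd)
    then have "(\<Sum>(r, s)\<in>{(r, s). r \<noteq> s}. in_flight r s (pair_word cs @ [snd_of c, a])) =
        (\<Sum>(r, s)\<in>{(r, s). r \<noteq> s}. in_flight r s [Snd p q m]) +
        (\<Sum>(r, s)\<in>{(r, s). r \<noteq> s}. in_flight r s [Snd p' q' m'])"
      by (simp add: sum.distrib split_beta)
    also have "\<dots> = 2"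
      using assms(3,4) by (simp add: sum_in_flight_Snd c Snd Sigma_ev_def)
    finally show ?thesis using assms(2) by simp
  next
    case (Rcv p' q' m')
    show ?thesis
    proof (cases "p = p' \<and> q = q'")
      case True
      then show ?thesis using assms(1) by (simp add: msgs_pair_word c Rcv)
    next
      case False
      then show ?thesis using prefix_length_le[OF assms(1)] by (auto simp: msgs_pair_word c Rcv)
    qed
  qed
qed

text \<open>States are classified by the words that lead to them: complete pairs for
  \<open>Z\<close>, complete pairs and one open send for \<open>Q c\<close>. Paths inherit
  compliance and the bound from the words that extend them. A finite word of \<open>FIFO\<close>
  leaves no message in transit, which excludes termination in \<open>Q c\<close>.\<close>

lemma sum_1_bounded_alternating:
  fixes M :: "('s, ('p::finite, 'v) event) fsm"
  assumes fsm: "is_fsm Sigma_ev M" and sink: "sink_final M"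
    and fifo: "\<And>w. w \<in> lang M \<Longrightarrow> w \<in> FIFO"
    and bound: "\<And>w. w \<in> lang M \<Longrightarrow> sum_bounded_word 1 w"
  shows "alternating M {s. \<exists>cs. wpath M (start M) (pair_word cs) s}
    (\<lambda>c. {s. \<exists>cs. wpath M (start M) (pair_word cs @ [snd_of c]) s})" (is "alternating M ?Z ?Q")
proof -
  have ok: "prefix (msgs (rcvs p q w)) (msgs (snds p q w))"
    "(\<Sum>(p, q)\<in>{(p, q). p \<noteq> q}. in_flight p q w) \<le> 1"
    if path: "wpath M (start M) w s" for p q w s
  proof -
    obtain W where W: "W \<in> lang M" "w \<in> fin_prefixes W"
      using wpath_extends[OF fsm sink path] by blast
    show "prefix (msgs (rcvs p q w)) (msgs (snds p q w))"
      using fifo[OF W(1)] W(2) unfolding FIFO_def channel_compliant_def by blast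
    show "(\<Sum>(p, q)\<in>{(p, q). p \<noteq> q}. in_flight p q w) \<le> 1"
      using bound[OF W(1)] W(2) unfolding sum_bounded_word_def by fastforce
  qed
  have "start M \<in> ?Z"
    by (rule CollectI, rule exI[of _ "[]"]) simp
  moreover have "\<exists>c. a = snd_of c \<and> s' \<in> ?Q c" if s: "s \<in> ?Z" "wstep M s a s'" for s a s'
  proof -
    obtain cs where "wpath M (start M) (pair_word cs) s" using s(1) by blast
    then have path: "wpath M (start M) (pair_word cs @ [a]) s'"
      using s(2) by (auto simp: wpath_append)
    then obtain c where "a = snd_of c" using compliant_after_pairs[OF ok(1)] by blast
    then show ?thesis using path by blast
  qed
  moreover have "\<not> terminates M t" if t: "t \<in> ?Q c" for t c
  proof
    assume "terminates M t"
    then obtain cs where "Fin (pair_word cs @ [snd_of c]) \<in> lang M"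
      using t unfolding lang_Fin by blast
    from fifo[OF this] have *: "\<forall>p q. msgs (snds p q (pair_word cs @ [snd_of c])) =
        msgs (rcvs p q (pair_word cs @ [snd_of c]))"
      unfolding FIFO_def by blast
    obtain p q m where "c = (p, q, m)" by (cases c)
    then show False using *[rule_format, of p q] by (simp add: msgs_pair_word)
  qed
  moreover have "a = rcv_of c \<and> s' \<in> ?Z" if t: "t \<in> ?Q c" "wstep M t a s'" for t c a s'
  proof -
    obtain cs where cs: "wpath M (start M) (pair_word cs @ [snd_of c]) t" using t(1) by blast
    then have path: "wpath M (start M) (pair_word cs @ [snd_of c, a]) s'"
      using t(2) by (auto simp: wpath_append)
    from cs obtain u where "wstep M u (snd_of c) t" by (auto simp: wpath_append)
    then have a: "a = rcv_of c"
      using compliant_after_send[OF ok[OF path]] wstep_label[OF fsm] t(2) by blast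
    have "wpath M (start M) (pair_word (cs @ [c])) s'" using path a by simp
    with a show ?thesis by blast
  qed
  ultimately show ?thesis unfolding alternating_def by blast
qed

section \<open>Transitions of the machine of a global type\<close>

lemma subterm_at_append:
  "subterm_at G (\<pi> @ \<rho>) = Option.bind (subterm_at G \<pi>) (\<lambda>H. subterm_at H \<rho>)"
  by (induction G \<pi> rule: subterm_at.induct) auto

fun paired :: "('p, 'v) interaction \<Rightarrow> ('p, 'v) label" where
  "paired (p, q, m) = Paired p q m"

lemma paired_simps [simp]:
  "paired c \<noteq> Event e" "Event e \<noteq> paired c" "paired c = paired d \<longleftrightarrow> c = d"
  by (cases c; cases d; simp)+

lemma GAut_End: "subterm_at G \<pi> = Some End \<Longrightarrow> (\<pi>, l, \<rho>) \<notin> delta (GAut G)"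
  by (simp add: GAut_def)

lemma GAut_Choice:
  assumes "subterm_at G \<pi> = Some (Choice bs)"
  shows "(\<pi>, l, \<rho>) \<in> delta (GAut G) \<longleftrightarrow> (\<exists>i<length bs. l = Some (paired (fst (bs ! i))) \<and> \<rho> = \<pi> @ [i])"
proof
  assume "(\<pi>, l, \<rho>) \<in> delta (GAut G)"
  then show "\<exists>i<length bs. l = Some (paired (fst (bs ! i))) \<and> \<rho> = \<pi> @ [i]"
    using assms by (auto simp: GAut_def)
next
  assume "\<exists>i<length bs. l = Some (paired (fst (bs ! i))) \<and> \<rho> = \<pi> @ [i]"
  then obtain i where i: "i < length bs" "l = Some (paired (fst (bs ! i)))" "\<rho> = \<pi> @ [i]" by blast
  obtain p q m G' where "bs ! i = ((p, q, m), G')" by (cases "bs ! i") auto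
  then show "(\<pi>, l, \<rho>) \<in> delta (GAut G)" using i assms by (auto simp: GAut_def)
qed

lemma GAut_Mu:
  "subterm_at G \<pi> = Some (Mu X H) \<Longrightarrow> (\<pi>, l, \<rho>) \<in> delta (GAut G) \<longleftrightarrow> l = None \<and> \<rho> = \<pi> @ [0]"
  by (auto simp: GAut_def)

lemma GAut_Var:
  "subterm_at G \<pi> = Some (Var X) \<Longrightarrow>
    (\<pi>, l, \<rho>) \<in> delta (GAut G) \<longleftrightarrow> l = None \<and> prefix \<rho> \<pi> \<and> binds G \<rho> X"
  by (auto simp: GAut_def)

lemma finals_GAut: "\<pi> \<in> finals (GAut G) \<longleftrightarrow> subterm_at G \<pi> = Some End"
  by (simp add: GAut_def)

lemma unpair_Inl_None: "(Inl s, None, x) \<in> delta (unpair M) \<longleftrightarrow> (\<exists>s'. x = Inl s' \<and> (s, None, s') \<in> delta M)"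
  by (auto simp: unpair_def)

lemma unpair_Inl_Some:
  "(Inl s, Some a, x) \<in> delta (unpair M) \<longleftrightarrow>
    (\<exists>s'. x = Inl s' \<and> (s, Some (Event a), s') \<in> delta M) \<or>
    (\<exists>c s'. a = snd_of c \<and> x = Inr (s, c, s') \<and> (s, Some (paired c), s') \<in> delta M)"
  by (auto simp: unpair_def)

lemma unpair_Inr:
  "(Inr (s, c, s'), l, x) \<in> delta (unpair M) \<longleftrightarrow>
    l = Some (rcv_of c) \<and> x = Inl s' \<and> (s, Some (paired c), s') \<in> delta M"
  by (cases c) (auto simp: unpair_def)

lemma finals_unpair [simp]: "Inl s \<in> finals (unpair M) \<longleftrightarrow> s \<in> finals M" "Inr y \<notin> finals (unpair M)"
  by (auto simp: unpair_def)

abbreviation GU where "GU G \<equiv> unpair (GAut G)"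

lemma GU_End:
  assumes "subterm_at G \<pi> = Some End"
  shows "terminates (GU G) (Inl \<pi>)" and "\<not> wstep (GU G) (Inl \<pi>) a x"
proof -
  show "terminates (GU G) (Inl \<pi>)"
    by (subst terminates_unfold) (simp add: finals_GAut assms)
  show "\<not> wstep (GU G) (Inl \<pi>) a x"
    by (subst wstep_unfold) (simp add: unpair_Inl_None unpair_Inl_Some GAut_End[OF assms])
qed

lemma GU_Choice:
  assumes "subterm_at G \<pi> = Some (Choice bs)"
  shows "\<not> terminates (GU G) (Inl \<pi>)"
    and "wstep (GU G) (Inl \<pi>) a x \<longleftrightarrow>
      (\<exists>i<length bs. a = snd_of (fst (bs ! i)) \<and> x = Inr (\<pi>, fst (bs ! i), \<pi> @ [i]))"
proof -
  show "\<not> terminates (GU G) (Inl \<pi>)"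
    by (subst terminates_unfold) (simp add: finals_GAut assms unpair_Inl_None GAut_Choice[OF assms])
  show "wstep (GU G) (Inl \<pi>) a x \<longleftrightarrow>
      (\<exists>i<length bs. a = snd_of (fst (bs ! i)) \<and> x = Inr (\<pi>, fst (bs ! i), \<pi> @ [i]))"
    by (subst wstep_unfold)
       (use assms in \<open>simp add: unpair_Inl_None unpair_Inl_Some GAut_Choice
         del: split_paired_Ex split_paired_All, blast\<close>)
qed

text \<open>Serves both binders and variables, which pass on the weak behaviour of their
  targets.\<close>

lemma GU_silent:
  assumes "\<And>l \<rho>'. (\<pi>, l, \<rho>') \<in> delta (GAut G) \<longleftrightarrow> l = None \<and> \<rho>' = \<rho>"
    and "subterm_at G \<pi> \<noteq> Some End"
  shows "terminates (GU G) (Inl \<pi>) \<longleftrightarrow> terminates (GU G) (Inl \<rho>)"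
    and "wstep (GU G) (Inl \<pi>) a x \<longleftrightarrow> wstep (GU G) (Inl \<rho>) a x"
proof -
  show "terminates (GU G) (Inl \<pi>) \<longleftrightarrow> terminates (GU G) (Inl \<rho>)"
    by (subst terminates_unfold) (simp add: assms finals_GAut unpair_Inl_None)
  show "wstep (GU G) (Inl \<pi>) a x \<longleftrightarrow> wstep (GU G) (Inl \<rho>) a x"
    by (subst wstep_unfold) (simp add: assms unpair_Inl_None unpair_Inl_Some)
qed

lemma unpair_Inr_terminates: "\<not> terminates (unpair M) (Inr (s, c, s'))"
  by (subst terminates_unfold) (simp add: unpair_Inr)

lemma unpair_Inr_wstep:
  "wstep (unpair M) (Inr (s, c, s')) a x \<longleftrightarrow>
    a = rcv_of c \<and> x = Inl s' \<and> (s, Some (paired c), s') \<in> delta M"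
  by (subst wstep_unfold) (auto simp: unpair_Inr)


section \<open>Unfolding a finite graph of interactions\<close>

text \<open>The environment maps the states met on the way from the root to the positions of their
  binders. A binder at position \<open>\<pi>\<close> uses the code of \<open>\<pi>\<close> as its variable, so distinct binders use
  distinct variables. The fuel counts the states that have not been met yet.\<close>

locale interaction_graph =
  fixes S :: "'s set"
    and succs :: "'s \<Rightarrow> (('p, 'v) interaction \<times> 's) list"
    and s0 :: 's
  assumes finite_S: "finite S" and s0: "s0 \<in> S"
    and succs_closed: "\<And>s c s'. s \<in> S \<Longrightarrow> (c, s') \<in> set (succs s) \<Longrightarrow> s' \<in> S"
    and succs_proper: "\<And>s p q m s'. ((p, q, m), s') \<in> set (succs s) \<Longrightarrow> p \<noteq> q"
begin

text \<open>In \<open>\<pi> @ [0, i]\<close> the \<open>0\<close> enters the body of the binder and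
  \<open>i\<close> selects the branch. A state with successors gets a binder when first met on a
  branch, whether or not a variable refers to it later. An unmet state with successors and no fuel
  left yields \<open>End\<close> as a default; \<open>occ_fuel\<close> shows that this does not
  arise in \<open>G\<close>.\<close>

primrec unravel :: "nat \<Rightarrow> nat list \<Rightarrow> ('s \<Rightarrow> nat list option) \<Rightarrow> 's \<Rightarrow> ('p, 'v) gtype" where
  "unravel 0 \<pi> env s =
     (if succs s = [] then End else case env s of Some \<rho> \<Rightarrow> Var (to_nat \<rho>) | None \<Rightarrow> End)"
| "unravel (Suc n) \<pi> env s =
     (if succs s = [] then End else case env s of Some \<rho> \<Rightarrow> Var (to_nat \<rho>)
      | None \<Rightarrow> Mu (to_nat \<pi>) (Choice (map (\<lambda>i. (fst (succs s ! i),
          unravel n (\<pi> @ [0, i]) (env(s \<mapsto> \<pi>)) (snd (succs s ! i)))) [0..<length (succs s)])))"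

definition branches ::
  "nat \<Rightarrow> nat list \<Rightarrow> ('s \<Rightarrow> nat list option) \<Rightarrow> 's \<Rightarrow> (('p, 'v) interaction \<times> ('p, 'v) gtype) list" where
  "branches n \<pi> env s = map (\<lambda>i. (fst (succs s ! i),
     unravel n (\<pi> @ [0, i]) (env(s \<mapsto> \<pi>)) (snd (succs s ! i)))) [0..<length (succs s)]"

lemma map_fst_branches: "map fst (branches n \<pi> env s) = map fst (succs s)"
  by (rule nth_equalityI) (simp_all add: branches_def)

lemma length_branches [simp]: "length (branches n \<pi> env s) = length (succs s)"
  by (simp add: branches_def)

lemma branches_nth: "i < length (succs s) \<Longrightarrow> branches n \<pi> env s ! i =
    (fst (succs s ! i), unravel n (\<pi> @ [0, i]) (env(s \<mapsto> \<pi>)) (snd (succs s ! i)))"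
  by (simp add: branches_def)

section \<open>The calls behind the subterms of the global type\<close>

definition G :: "('p, 'v) gtype" where
  "G = unravel (card S) [] Map.empty s0"

text \<open>Collects the arguments of the calls of \<open>unravel\<close> made while
  \<open>G\<close> is built, so that facts about its subterms can be proved by induction over these
  calls.\<close>

inductive occ :: "nat list \<Rightarrow> nat \<Rightarrow> ('s \<Rightarrow> nat list option) \<Rightarrow> 's \<Rightarrow> bool" where
  root: "occ [] (card S) Map.empty s0"
| child: "occ \<pi> (Suc n) env s \<Longrightarrow> env s = None \<Longrightarrow> i < length (succs s) \<Longrightarrow>
    occ (\<pi> @ [0, i]) n (env(s \<mapsto> \<pi>)) (snd (succs s ! i))"

text \<open>The cardinality is the invariant for the fuel: it starts at \<open>card S\<close>, and
  each binder adds one new state to the environment.\<close>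

lemma occ_states:
  "occ \<pi> n env s \<Longrightarrow> s \<in> S \<and> dom env \<subseteq> S \<and> card (S - dom env) = n"
proof (induction rule: occ.induct)
  case root
  show ?case using s0 by simp
next
  case (child \<pi> n env s i)
  have "snd (succs s ! i) \<in> S"
    using child succs_closed[of s "fst (succs s ! i)" "snd (succs s ! i)"] by simp
  moreover have "S - dom (env(s \<mapsto> \<pi>)) = (S - dom env) - {s}" by auto
  moreover have "s \<in> S - dom env" using child by auto
  ultimately show ?case using child finite_S by (auto simp del: fun_upd_apply)
qed

text \<open>A state of \<open>S\<close> outside \<open>dom env\<close> is one of the
  \<open>n\<close> unmet states, so \<open>n\<close> is positive.\<close>

lemma occ_fuel:
  assumes "occ \<pi> n env s" and "env s = None"
  obtains k where "n = Suc k"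
proof (cases n)
  case 0
  then have "S - dom env = {}" using occ_states[OF assms(1)] finite_S by simp
  then show ?thesis using occ_states[OF assms(1)] assms(2) by auto
qed

lemma unravel_binder:
  "succs s \<noteq> [] \<Longrightarrow> env s = None \<Longrightarrow>
    unravel (Suc n) \<pi> env s = Mu (to_nat \<pi>) (Choice (branches n \<pi> env s))"
  by (simp add: branches_def)

lemma unravel_Var: "succs s \<noteq> [] \<Longrightarrow> env s = Some \<rho> \<Longrightarrow> unravel n \<pi> env s = Var (to_nat \<rho>)"
  by (cases n) auto

lemma unravel_End: "succs s = [] \<Longrightarrow> unravel n \<pi> env s = End"
  by (cases n) auto

lemma occ_subterm: "occ \<pi> n env s \<Longrightarrow> subterm_at G \<pi> = Some (unravel n \<pi> env s)"
proof (induction rule: occ.induct)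
  case root
  show ?case by (simp add: G_def)
next
  case (child \<pi> n env s i)
  then have "succs s \<noteq> []" by auto
  then show ?case
    using child
    by (simp add: subterm_at_append unravel_binder branches_nth del: unravel.simps fun_upd_apply)
qed

lemma occ_binder:
  assumes "occ \<pi> (Suc n) env s" and "env s = None" and "succs s \<noteq> []"
  shows "subterm_at G \<pi> = Some (Mu (to_nat \<pi>) (Choice (branches n \<pi> env s)))"
    and "subterm_at G (\<pi> @ [0]) = Some (Choice (branches n \<pi> env s))"
  using occ_subterm[OF assms(1)] assms(2,3)
  by (simp_all add: subterm_at_append unravel_binder del: unravel.simps)

text \<open>An entry of the environment points to an ancestor binder that stands for the same state.
  The \<open>0\<close> after \<open>\<rho>\<close> shows that the path passes the choice directly
  under this binder, which yields guardedness.\<close>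

lemma occ_env:
  "occ \<pi> n env s \<Longrightarrow> env s' = Some \<rho> \<Longrightarrow>
    (\<exists>\<sigma>. \<pi> = \<rho> @ 0 # \<sigma>) \<and> succs s' \<noteq> [] \<and> (\<exists>k env'. occ \<rho> (Suc k) env' s' \<and> env' s' = None)"
proof (induction arbitrary: s' rule: occ.induct)
  case (child \<pi> n env s i)
  show ?case
  proof (cases "s' = s")
    case True
    then show ?thesis using child by auto
  next
    case False
    then have "env s' = Some \<rho>" using child.prems by simp
    from child.IH[OF this] show ?thesis by auto
  qed
qed simp

text \<open>A binder and the choice in its body come from one call, so a position is that of a call
  or one step further, at the choice.\<close>

lemma subterm_occ:
  assumes "subterm_at G \<pi> = Some H"
  shows "(\<exists>n env s. occ \<pi> n env s \<and> H = unravel n \<pi> env s) \<or>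
    (\<exists>\<rho> n env s. \<pi> = \<rho> @ [0] \<and> occ \<rho> (Suc n) env s \<and> env s = None \<and> succs s \<noteq> [] \<and>
      H = Choice (branches n \<rho> env s))"
  using assms
proof (induction \<pi> arbitrary: H rule: rev_induct)
  case Nil
  then show ?case using root by (auto simp: G_def)
next
  case (snoc i \<pi>)
  then obtain H0 where H0: "subterm_at G \<pi> = Some H0" "subterm_at H0 [i] = Some H"
    by (auto simp: subterm_at_append bind_eq_Some_conv)
  from snoc.IH[OF H0(1)] show ?case
  proof (elim disjE exE conjE)
    fix n env s
    assume o: "occ \<pi> n env s" "H0 = unravel n \<pi> env s"
    have ne: "succs s \<noteq> []" using H0(2) o(2) unravel_End by auto
    have none: "env s = None" using H0(2) o(2) unravel_Var[OF ne] by (cases "env s") auto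
    obtain k where k: "n = Suc k" using occ_fuel[OF o(1) none] .
    have "i = 0" "H = Choice (branches k \<pi> env s)"
      using H0(2) o(2) unfolding k unravel_binder[of s env, OF ne none] by (auto split: if_splits)
    then show ?thesis using o(1) k ne none by blast
  next
    fix \<rho> n env s
    assume *: "\<pi> = \<rho> @ [0]" "occ \<rho> (Suc n) env s" "env s = None" "H0 = Choice (branches n \<rho> env s)"
    then have "i < length (succs s)" "H = unravel n (\<rho> @ [0, i]) (env(s \<mapsto> \<rho>)) (snd (succs s ! i))"
      using H0(2) by (auto simp: branches_nth split: if_splits)
    moreover have "\<pi> @ [i] = \<rho> @ [0, i]" using *(1) by simp
    ultimately have "occ (\<pi> @ [i]) n (env(s \<mapsto> \<rho>)) (snd (succs s ! i))"
      "H = unravel n (\<pi> @ [i]) (env(s \<mapsto> \<rho>)) (snd (succs s ! i))"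
      using child[OF *(2,3), of i] by simp_all
    then show ?thesis by blast
  qed
qed

lemma unravel_not_Choice: "unravel n \<pi> env s \<noteq> Choice bs"
  by (cases n) (auto split: option.split)

lemma subterm_Choice:
  assumes "subterm_at G \<pi> = Some (Choice bs)"
  shows "\<exists>\<rho> n env s. bs = branches n \<rho> env s \<and> s \<in> S \<and> succs s \<noteq> []"
proof -
  from subterm_occ[OF assms] obtain \<rho> n env s
    where "occ \<rho> (Suc n) env s" "succs s \<noteq> []" "bs = branches n \<rho> env s"
    unfolding gtype.inject using unravel_not_Choice[symmetric] by blast
  then show ?thesis using occ_states by blast
qed

lemma subterm_Var:
  assumes "subterm_at G \<pi> = Some (Var X)"
  shows "\<exists>n env s \<rho>. occ \<pi> n env s \<and> succs s \<noteq> [] \<and> env s = Some \<rho> \<and> X = to_nat \<rho>"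
proof -
  obtain n env s where o: "occ \<pi> n env s" "Var X = unravel n \<pi> env s"
    using subterm_occ[OF assms] by auto
  then show ?thesis by (cases n) (auto split: if_splits option.splits)
qed

lemma binds_iff:
  "binds G \<rho> X \<longleftrightarrow> X = to_nat \<rho> \<and> (\<exists>n env s. occ \<rho> (Suc n) env s \<and> env s = None \<and> succs s \<noteq> [])"
proof
  assume "binds G \<rho> X"
  then obtain H where H: "subterm_at G \<rho> = Some (Mu X H)" unfolding binds_def by blast
  then obtain n env s where o: "occ \<rho> n env s" "Mu X H = unravel n \<rho> env s"
    using subterm_occ[OF H] by auto
  then show "X = to_nat \<rho> \<and> (\<exists>n env s. occ \<rho> (Suc n) env s \<and> env s = None \<and> succs s \<noteq> [])"
    by (cases n) (auto split: if_splits option.splits)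
next
  assume "X = to_nat \<rho> \<and> (\<exists>n env s. occ \<rho> (Suc n) env s \<and> env s = None \<and> succs s \<noteq> [])"
  then show "binds G \<rho> X" using occ_binder(1) unfolding binds_def by blast
qed

lemma occ_env_binds:
  assumes "occ \<pi> n env s" and "env s' = Some \<rho>"
  shows "prefix \<rho> \<pi>" and "prefix (\<rho> @ [0]) \<pi>" and "binds G \<rho> (to_nat \<rho>)"
  using occ_env[OF assms] unfolding binds_iff by (auto simp: prefix_def)

lemma global_type_G: "global_type G"
  unfolding global_type_def
proof (intro conjI allI impI)
  show "all_choices (\<lambda>bs. bs \<noteq> [] \<and> (\<forall>((p, q, m), G')\<in>set bs. p \<noteq> q)) G"
    unfolding all_choices_def
  proof (intro allI impI)
    fix \<pi> bs
    assume "subterm_at G \<pi> = Some (Choice bs)"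
    then obtain \<rho> n env s where bs: "bs = branches n \<rho> env s" "succs s \<noteq> []"
      using subterm_Choice by blast
    have "p \<noteq> q" if "((p, q, m), G') \<in> set bs" for p q m G'
    proof -
      have "(p, q, m) \<in> set (map fst bs)" using that by force
      then show ?thesis unfolding bs(1) map_fst_branches using succs_proper by auto
    qed
    moreover have "bs \<noteq> []" using bs length_branches by (metis length_0_conv)
    ultimately show "bs \<noteq> [] \<and> (\<forall>((p, q, m), G')\<in>set bs. p \<noteq> q)" by auto
  qed
next
  fix \<pi> X
  assume "subterm_at G \<pi> = Some (Var X)"
  then show "\<exists>\<rho>. prefix \<rho> \<pi> \<and> binds G \<rho> X"
    using subterm_Var[of \<pi> X] occ_env_binds(1,3) by blast
next
  fix \<rho> \<rho>' X
  assume "binds G \<rho> X \<and> binds G \<rho>' X"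
  then show "\<rho> = \<rho>'" by (auto simp: binds_iff)
next
  fix \<pi> \<rho> X
  assume *: "subterm_at G \<pi> = Some (Var X) \<and> prefix \<rho> \<pi> \<and> binds G \<rho> X"
  then obtain n env s where o: "occ \<pi> n env s" "env s = Some \<rho>"
    using subterm_Var[of \<pi> X] by (auto simp: binds_iff)
  obtain k env' s' where "occ \<rho> (Suc k) env' s'" "env' s' = None" "succs s' \<noteq> []"
    using * by (auto simp: binds_iff)
  \<comment> \<open>The guard is the choice in the body of the binder at
    \<open>\<rho>\<close>.\<close>
  then show "\<exists>\<sigma> bs. prefix \<rho> \<sigma> \<and> prefix \<sigma> \<pi> \<and> subterm_at G \<sigma> = Some (Choice bs)"
    using occ_binder(2) occ_env_binds(2)[OF o] by (intro exI[of _ "\<rho> @ [0]"]) auto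
qed

section \<open>Weak steps from positions of the global type\<close>

lemma occ_End:
  assumes "occ \<pi> n env s" and "succs s = []"
  shows "terminates (GU G) (Inl \<pi>)" and "\<not> wstep (GU G) (Inl \<pi>) a x"
proof -
  have "subterm_at G \<pi> = Some End" using occ_subterm[OF assms(1)] unravel_End[OF assms(2)] by simp
  from GU_End[OF this] show "terminates (GU G) (Inl \<pi>)" "\<not> wstep (GU G) (Inl \<pi>) a x" .
qed

text \<open>A variable leads to its binder and a binder to its choice, so after at most two silent
  moves a choice for the same state \<open>s\<close> is reached; \<open>\<rho>\<close> is the
  position of the binder.\<close>

lemma occ_resolve:
  assumes "occ \<pi> n env s" and ne: "succs s \<noteq> []"
  shows "\<exists>\<rho> k env'. occ \<rho> (Suc k) env' s \<and> env' s = None \<and>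
    (terminates (GU G) (Inl \<pi>) \<longleftrightarrow> terminates (GU G) (Inl (\<rho> @ [0]))) \<and>
    (\<forall>a x. wstep (GU G) (Inl \<pi>) a x \<longleftrightarrow> wstep (GU G) (Inl (\<rho> @ [0])) a x)"
proof -
  have at_binder: "(terminates (GU G) (Inl \<rho>) \<longleftrightarrow> terminates (GU G) (Inl (\<rho> @ [0]))) \<and>
      (\<forall>a x. wstep (GU G) (Inl \<rho>) a x \<longleftrightarrow> wstep (GU G) (Inl (\<rho> @ [0])) a x)"
    if o: "occ \<rho> (Suc k) env' s" "env' s = None" for \<rho> k env'
  proof -
    note sub = occ_binder(1)[OF o ne]
    have "subterm_at G \<rho> \<noteq> Some End" using sub by simp
    from GU_silent[OF GAut_Mu[OF sub] this] show ?thesis by blast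
  qed
  show ?thesis
  proof (cases "env s")
    case None
    obtain k where "n = Suc k" using occ_fuel[OF assms(1) None] .
    then show ?thesis using at_binder[of \<pi> k env] None assms(1) by blast
  next
    case (Some \<rho>)
    obtain k env' where o: "occ \<rho> (Suc k) env' s" "env' s = None"
      using occ_env[OF assms(1) Some] by blast
    have sub: "subterm_at G \<pi> = Some (Var (to_nat \<rho>))"
      using occ_subterm[OF assms(1)] unravel_Var[of s env, OF ne Some] by simp
    have "(\<pi>, l, \<rho>') \<in> delta (GAut G) \<longleftrightarrow> l = None \<and> \<rho>' = \<rho>" for l \<rho>'
      using GAut_Var[OF sub] occ_env_binds(1,3)[OF assms(1) Some] by (auto simp: binds_iff)
    from GU_silent[OF this] sub
    have "(terminates (GU G) (Inl \<pi>) \<longleftrightarrow> terminates (GU G) (Inl \<rho>)) \<and>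
        (\<forall>a x. wstep (GU G) (Inl \<pi>) a x \<longleftrightarrow> wstep (GU G) (Inl \<rho>) a x)"
      by simp
    with at_binder[OF o] o show ?thesis by blast
  qed
qed

text \<open>Forgets fuel and environment: which interactions a position offers depends only on the
  state for which it stands.\<close>

definition located :: "nat list \<Rightarrow> 's \<Rightarrow> bool" where
  "located \<pi> s \<longleftrightarrow> (\<exists>n env. occ \<pi> n env s)"

lemma located_root: "located [] s0"
  unfolding located_def using root by blast

lemma located_terminal:
  assumes "located \<pi> s" and "succs s = []"
  shows "terminates (GU G) (Inl \<pi>)" and "\<not> wstep (GU G) (Inl \<pi>) a x"
  using assms occ_End unfolding located_def by blast+

lemma located_steps:
  assumes "located \<pi> s" and ne: "succs s \<noteq> []"
  obtains \<rho> where "\<not> terminates (GU G) (Inl \<pi>)"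
    and "\<And>i. i < length (succs s) \<Longrightarrow> located (\<rho> @ [0, i]) (snd (succs s ! i))"
    and "\<And>i. i < length (succs s) \<Longrightarrow>
      (\<rho> @ [0], Some (paired (fst (succs s ! i))), \<rho> @ [0, i]) \<in> delta (GAut G)"
    and "\<And>a x. wstep (GU G) (Inl \<pi>) a x \<longleftrightarrow> (\<exists>i<length (succs s).
        a = snd_of (fst (succs s ! i)) \<and> x = Inr (\<rho> @ [0], fst (succs s ! i), \<rho> @ [0, i]))"
proof -
  obtain n env where occ: "occ \<pi> n env s" using assms(1) unfolding located_def by blast
  obtain \<rho> k env' where o: "occ \<rho> (Suc k) env' s" "env' s = None"
    and fin: "terminates (GU G) (Inl \<pi>) \<longleftrightarrow> terminates (GU G) (Inl (\<rho> @ [0]))"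
    and step: "\<And>a x. wstep (GU G) (Inl \<pi>) a x \<longleftrightarrow> wstep (GU G) (Inl (\<rho> @ [0])) a x"
    using occ_resolve[OF occ ne] by blast
  note sub = occ_binder(2)[OF o ne]
  show ?thesis
  proof (rule that)
    show "\<not> terminates (GU G) (Inl \<pi>)" using GU_Choice(1)[OF sub] fin by simp
    show "located (\<rho> @ [0, i]) (snd (succs s ! i))" if "i < length (succs s)" for i
      unfolding located_def using child[OF o that] by blast
    show "(\<rho> @ [0], Some (paired (fst (succs s ! i))), \<rho> @ [0, i]) \<in> delta (GAut G)"
      if "i < length (succs s)" for i
      unfolding GAut_Choice[OF sub] using that by (auto simp: branches_nth)
    show "wstep (GU G) (Inl \<pi>) a x \<longleftrightarrow> (\<exists>i<length (succs s).
        a = snd_of (fst (succs s ! i)) \<and> x = Inr (\<rho> @ [0], fst (succs s ! i), \<rho> @ [0, i]))" for a x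
      unfolding step GU_Choice(2)[OF sub] by (auto simp: branches_nth)
  qed
qed

lemma located_terminates:
  assumes "located \<pi> s"
  shows "terminates (GU G) (Inl \<pi>) \<longleftrightarrow> succs s = []"
proof (cases "succs s = []")
  case True
  then show ?thesis using located_terminal(1)[OF assms] by simp
next
  case False
  show ?thesis by (rule located_steps[OF assms False]) (simp add: False)
qed

lemma located_wstep:
  assumes "located \<pi> s" and "wstep (GU G) (Inl \<pi>) a x"
  obtains \<rho> c \<sigma> s' where "a = snd_of c" and "x = Inr (\<rho>, c, \<sigma>)"
    and "(c, s') \<in> set (succs s)" and "located \<sigma> s'"
proof -
  have ne: "succs s \<noteq> []" using located_terminal(2)[OF assms(1)] assms(2) by blast
  show thesis
  proof (rule located_steps[OF assms(1) ne])
    fix \<rho>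
    assume loc: "\<And>i. i < length (succs s) \<Longrightarrow> located (\<rho> @ [0, i]) (snd (succs s ! i))"
      and step: "\<And>a x. wstep (GU G) (Inl \<pi>) a x \<longleftrightarrow> (\<exists>i<length (succs s).
        a = snd_of (fst (succs s ! i)) \<and> x = Inr (\<rho> @ [0], fst (succs s ! i), \<rho> @ [0, i]))"
    obtain i where "i < length (succs s)" "a = snd_of (fst (succs s ! i))"
      "x = Inr (\<rho> @ [0], fst (succs s ! i), \<rho> @ [0, i])"
      using assms(2) unfolding step by blast
    then show thesis using loc[of i] that[of "fst (succs s ! i)" _ _ "snd (succs s ! i)"] by simp
  qed
qed

lemma located_pstep_forward:
  assumes "located \<pi> s" and "pstep (GU G) (Inl \<pi>) c x"
  shows "\<exists>\<rho> s'. x = Inl \<rho> \<and> (c, s') \<in> set (succs s) \<and> located \<rho> s'"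
proof -
  obtain t where t: "wstep (GU G) (Inl \<pi>) (snd_of c) t" "wstep (GU G) t (rcv_of c) x"
    using assms(2) unfolding pstep_def by blast
  obtain \<rho> d \<sigma> s' where d: "snd_of c = snd_of d" "t = Inr (\<rho>, d, \<sigma>)" "(d, s') \<in> set (succs s)"
    "located \<sigma> s'"
    using located_wstep[OF assms(1) t(1)] .
  have "c = d" using d(1) by (cases c; cases d) simp
  moreover have "x = Inl \<sigma>" using t(2) unfolding d(2) unpair_Inr_wstep by simp
  ultimately show ?thesis using d(3,4) by blast
qed

lemma located_pstep_backward:
  assumes "located \<pi> s" and "(c, s') \<in> set (succs s)"
  shows "\<exists>\<rho>. pstep (GU G) (Inl \<pi>) c (Inl \<rho>) \<and> located \<rho> s'"
proof -
  obtain i where i: "i < length (succs s)" "succs s ! i = (c, s')"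
    using assms(2) by (auto simp: in_set_conv_nth)
  then have ne: "succs s \<noteq> []" by auto
  show ?thesis
  proof (rule located_steps[OF assms(1) ne])
    fix \<rho>
    assume loc: "\<And>i. i < length (succs s) \<Longrightarrow> located (\<rho> @ [0, i]) (snd (succs s ! i))"
      and del: "\<And>i. i < length (succs s) \<Longrightarrow>
        (\<rho> @ [0], Some (paired (fst (succs s ! i))), \<rho> @ [0, i]) \<in> delta (GAut G)"
      and step: "\<And>a x. wstep (GU G) (Inl \<pi>) a x \<longleftrightarrow> (\<exists>i<length (succs s).
        a = snd_of (fst (succs s ! i)) \<and> x = Inr (\<rho> @ [0], fst (succs s ! i), \<rho> @ [0, i]))"
    have "wstep (GU G) (Inl \<pi>) (snd_of c) (Inr (\<rho> @ [0], c, \<rho> @ [0, i]))"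
      unfolding step using i by (intro exI[of _ i]) simp
    moreover have "wstep (GU G) (Inr (\<rho> @ [0], c, \<rho> @ [0, i])) (rcv_of c) (Inl (\<rho> @ [0, i]))"
      unfolding unpair_Inr_wstep using del[OF i(1)] i(2) by simp
    ultimately have "pstep (GU G) (Inl \<pi>) c (Inl (\<rho> @ [0, i]))"
      unfolding pstep_def by blast
    then show ?thesis using loc[OF i(1)] i(2) by auto
  qed
qed

text \<open>Every visible transition of \<open>GAut G\<close> is a pair, which \<open>unpair\<close>
  expands into a send and its receive.\<close>

lemma GU_alternating:
  "alternating (GU G) {Inl \<pi> | \<pi>. \<exists>s. located \<pi> s} (\<lambda>c. {Inr (\<pi>, c, \<rho>) | \<pi> \<rho>. \<exists>s. located \<rho> s})"
  (is "alternating _ ?Z ?Q")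
proof -
  have "start (GU G) = Inl []" by (simp add: unpair_def GAut_def)
  then have "start (GU G) \<in> ?Z" using located_root by auto
  moreover have "\<exists>c. a = snd_of c \<and> x \<in> ?Q c" if y: "y \<in> ?Z" and w: "wstep (GU G) y a x" for y a x
  proof -
    obtain \<pi> s where y: "y = Inl \<pi>" "located \<pi> s" using y by blast
    obtain \<rho> c \<sigma> s' where c: "a = snd_of c" "x = Inr (\<rho>, c, \<sigma>)" "located \<sigma> s'"
      using located_wstep[OF y(2) w[unfolded y(1)]] .
    then show ?thesis by (intro exI[of _ c]) blast
  qed
  moreover have "\<not> terminates (GU G) t \<and> (wstep (GU G) t a x \<longrightarrow> a = rcv_of c \<and> x \<in> ?Z)"
    if t: "t \<in> ?Q c" for t c a x
  proof -
    obtain \<pi> \<rho> s where t: "t = Inr (\<pi>, c, \<rho>)" "located \<rho> s" using t by blast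
    show ?thesis unfolding t(1) unpair_Inr_wstep using t(2) unpair_Inr_terminates[of "GAut G" \<pi> c \<rho>] by auto
  qed
  ultimately show ?thesis unfolding alternating_def by blast
qed

end

section \<open>Dense machines and choice restrictions\<close>

lemma dense_estep_unique:
  assumes "is_fsm A M" and "dense M" and "estep M s s'" and "(s, l, t) \<in> delta M"
  shows "l = None" and "t = s'"
proof -
  have "s \<in> states M" using assms(1,3) by (auto simp: is_fsm_def)
  then have ex1: "\<exists>!t. t \<in> outgoing M s" using assms(2,3) unfolding dense_def by blast
  have "(s, None, s') \<in> outgoing M s" "(s, l, t) \<in> outgoing M s"
    using assms(3,4) by (auto simp: outgoing_def)
  then have "(s, l, t) = (s, None, s')" using ex1 by blast
  then show "l = None" and "t = s'" by simp_all
qed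

text \<open>By density a silent path never branches and cannot continue past a state with a visible
  transition, so the two paths from \<open>s\<close> agree.\<close>

lemma wstep_source_unique:
  assumes fsm: "is_fsm A M" and dense: "dense M"
    and "(estep M)\<^sup>*\<^sup>* s u" and "(u, Some a, t) \<in> delta M"
    and "(estep M)\<^sup>*\<^sup>* s u'" and "(u', Some a', t') \<in> delta M"
  shows "u' = u"
  using assms(3,5)
proof (induction rule: converse_rtranclp_induct)
  case base
  from base show ?case
  proof (cases rule: converse_rtranclpE)
    case (step v)
    then show ?thesis using dense_estep_unique(1)[OF fsm dense step(1) assms(4)] by simp
  qed simp
next
  case (step s v)
  from step.prems show ?case
  proof (cases rule: converse_rtranclpE)
    case base
    then show ?thesis using dense_estep_unique(1)[OF fsm dense step(1)] assms(6) by blast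
  next
    case (step v')
    then show ?thesis
      using dense_estep_unique(2)[OF fsm dense \<open>estep M s v\<close> step(1)] \<open>(estep M)\<^sup>*\<^sup>* v u' \<Longrightarrow> u' = u\<close> by simp
  qed
qed

text \<open>The silent path to \<open>u\<close> is forced. None of its states is final, since each
  has an exit, and at \<open>u\<close> no silent exit is left, which rules out divergence as
  well.\<close>

lemma wstep_not_terminates:
  assumes fsm: "is_fsm A M" and dense: "dense M" and sink: "sink_final M"
    and "wstep M s a s'"
  shows "\<not> terminates M s"
proof -
  obtain u where u: "(estep M)\<^sup>*\<^sup>* s u" "(u, Some a, s') \<in> delta M"
    using assms(4) unfolding wstep_def by blast
  have not_final: "x \<notin> finals M" if "(x, l, y) \<in> delta M" for x l y
  proof
    assume "x \<in> finals M"
    then have "outgoing M x = {}" using sink fsm by (auto simp: sink_final_def is_fsm_def)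
    then show False using that by (auto simp: outgoing_def)
  qed
  from u(1) show ?thesis
  proof (induction rule: converse_rtranclp_induct)
    case base
    have "\<not> estep M u v" for v using dense_estep_unique(1)[OF fsm dense _ u(2)] by blast
    then show ?case
      using not_final[OF u(2)] unfolding terminates_unfold[of M u] by blast
  next
    case (step x y)
    then show ?case
      using not_final[OF step(1)] dense_estep_unique(2)[OF fsm dense step(1)]
      unfolding terminates_unfold[of M x] by blast
  qed
qed

text \<open>Density gives both sends a common source, and both receives one if the sends end in the
  same state. Choice restrictions on single transitions can then be applied to interactions.\<close>

lemma psteps_cases:
  assumes fsm: "is_fsm A M" and dense: "dense M"
    and "pstep M s c s1" and "pstep M s d s2"
  obtains u t1 t2 v1 v2 where "u \<in> states M" and "v1 \<in> states M"
    and "(u, Some (snd_of c), t1) \<in> delta M" and "(u, Some (snd_of d), t2) \<in> delta M"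
    and "(v1, Some (rcv_of c), s1) \<in> delta M" and "(v2, Some (rcv_of d), s2) \<in> delta M"
    and "t1 = t2 \<longrightarrow> v2 = v1"
proof -
  obtain t1 t2 where t: "wstep M s (snd_of c) t1" "wstep M t1 (rcv_of c) s1"
    "wstep M s (snd_of d) t2" "wstep M t2 (rcv_of d) s2"
    using assms(3,4) unfolding pstep_def by blast
  obtain u u' where u: "(estep M)\<^sup>*\<^sup>* s u" "(u, Some (snd_of c), t1) \<in> delta M"
    "(estep M)\<^sup>*\<^sup>* s u'" "(u', Some (snd_of d), t2) \<in> delta M"
    using t(1,3) unfolding wstep_def by blast
  obtain v1 v2 where v: "(estep M)\<^sup>*\<^sup>* t1 v1" "(v1, Some (rcv_of c), s1) \<in> delta M"
    "(estep M)\<^sup>*\<^sup>* t2 v2" "(v2, Some (rcv_of d), s2) \<in> delta M"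
    using t(2,4) unfolding wstep_def by blast
  have "u' = u" by (rule wstep_source_unique[OF fsm dense u])
  moreover have "v2 = v1" if "t1 = t2"
    using wstep_source_unique[OF fsm dense v(1,2) v(3)[folded that] v(4)] .
  moreover have "u \<in> states M" "v1 \<in> states M" using u(2) v(2) fsm by (auto simp: is_fsm_def)
  ultimately show ?thesis using u(2,4) v(2,4) by (intro that[of u v1 t1 t2 v2]) simp_all
qed

lemma deterministic_pstep:
  assumes "is_fsm A M" and "dense M" and det: "deterministic M"
    and "pstep M s c s1" and "pstep M s c s2"
  shows "s1 = s2"
proof (rule psteps_cases[OF assms(1,2,4,5)])
  fix u t1 t2 v1 v2
  assume *: "(u, Some (snd_of c), t1) \<in> delta M" "(u, Some (snd_of c), t2) \<in> delta M"
    "(v1, Some (rcv_of c), s1) \<in> delta M" "(v2, Some (rcv_of c), s2) \<in> delta M" "t1 = t2 \<longrightarrow> v2 = v1"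
  have "t1 = t2" using det *(1,2) unfolding deterministic_def by blast
  then have "v2 = v1" using *(5) by simp
  then show ?thesis using det *(3,4) unfolding deterministic_def by blast
qed

lemma sender_drivenD:
  assumes "sender_driven M" and "u \<in> states M"
    and "(u, Some a, t) \<in> delta M" and "(u, Some b, t') \<in> delta M" and "(a, t) \<noteq> (b, t')"
  shows "\<exists>p q m q' m'. a = Snd p q m \<and> b = Snd p q' m'" and "a \<noteq> b"
proof -
  have out: "(u, Some a, t) \<in> outgoing M u" "(u, Some b, t') \<in> outgoing M u"
    using assms(3,4) by (auto simp: outgoing_def)
  then have "branching M u" using assms(5) unfolding branching_def by blast
  then obtain p where p: "\<forall>(s1, a, s2)\<in>outgoing M u. \<exists>q m. a = Some (Snd p q m)"
    and inj: "inj_on (\<lambda>(s1, a, s2). a) (outgoing M u)"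
    using assms(1,2) unfolding sender_driven_def by blast
  show "\<exists>p q m q' m'. a = Snd p q m \<and> b = Snd p q' m'" using bspec[OF p out(1)] bspec[OF p out(2)] by auto
  show "a \<noteq> b" using inj_onD[OF inj _ out] assms(5) by auto
qed

lemma directedD:
  assumes "directed M" and "u \<in> states M"
    and "(u, Some a, t) \<in> delta M" and "(u, Some b, t') \<in> delta M" and "(a, t) \<noteq> (b, t')"
  shows "receiver a = receiver b"
proof -
  have out: "(u, Some a, t) \<in> outgoing M u" "(u, Some b, t') \<in> outgoing M u"
    using assms(3,4) by (auto simp: outgoing_def)
  then have "branching M u" using assms(5) unfolding branching_def by blast
  then obtain q where q: "\<forall>(s1, a, s2)\<in>outgoing M u. \<exists>p m. a = Some (Snd p q m)"
    using assms(1,2) unfolding directed_def by blast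
  show ?thesis using bspec[OF q out(1)] bspec[OF q out(2)] by auto
qed

lemma snd_of_inject [simp]: "snd_of c = snd_of d \<longleftrightarrow> c = d"
  by (cases c; cases d) simp

text \<open>The sends of the two interactions leave one state, so different ones fall under the
  branching condition. A receive cannot branch, because all exits of a branching state are sends;
  hence the interaction determines its target.\<close>

lemma sender_driven_pstep:
  assumes "is_fsm A M" and "dense M" and sd: "sender_driven M"
    and "pstep M s c s1" and "pstep M s d s2"
  shows "c = d \<Longrightarrow> s1 = s2" and "fst c = fst d" and "directed M \<Longrightarrow> fst (snd c) = fst (snd d)"
proof -
  obtain u t1 t2 v1 v2 where uv: "u \<in> states M" "v1 \<in> states M"
    and u: "(u, Some (snd_of c), t1) \<in> delta M" "(u, Some (snd_of d), t2) \<in> delta M"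
    and v: "(v1, Some (rcv_of c), s1) \<in> delta M" "(v2, Some (rcv_of d), s2) \<in> delta M"
    and tv: "t1 = t2 \<longrightarrow> v2 = v1"
    by (rule psteps_cases[OF assms(1,2,4,5)])
  obtain p q m p' q' m' where cd: "c = (p, q, m)" "d = (p', q', m')" by (cases c, cases d)
  show "fst c = fst d"
  proof (cases "c = d")
    case False
    then have "(snd_of c, t1) \<noteq> (snd_of d, t2)" by simp
    from sender_drivenD(1)[OF sd uv(1) u this] show ?thesis by (simp add: cd)
  qed simp
  show "fst (snd c) = fst (snd d)" if dir: "directed M"
  proof (cases "c = d")
    case False
    then have "(snd_of c, t1) \<noteq> (snd_of d, t2)" by simp
    from directedD[OF dir uv(1) u this] show ?thesis by (simp add: cd)
  qed simp
  show "s1 = s2" if "c = d"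
  proof (rule ccontr)
    assume "s1 \<noteq> s2"
    have "t1 = t2" using sender_drivenD(2)[OF sd uv(1) u] that by auto
    then have v2: "(v1, Some (rcv_of d), s2) \<in> delta M" using v(2) tv by simp
    have "(rcv_of c, s1) \<noteq> (rcv_of d, s2)" using \<open>s1 \<noteq> s2\<close> by simp
    from sender_drivenD(1)[OF sd uv(2) v(1) v2 this] show False by (simp add: cd)
  qed
qed


section \<open>The global type of a sum-1-bounded machine\<close>

theorem theorem6p1:
  fixes M :: "('s, ('p::finite, 'v::finite) label) fsm"
  assumes "sigma1_psm M"
    and "sink_final M"
  shows "\<exists>G :: ('p, 'v) gtype. global_type G \<and>
           core_lang (GAut G) = core_lang M \<and>
           closure_indist (core_lang (GAut G)) = semantics M \<and>
           (\<forall>c. psm_choice c M \<longrightarrow> gtype_choice c G)"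
proof -
  define N where "N = unpair M"
  have fsm: "is_fsm Sigma_ev N" and dense: "dense N"
    and fifo: "\<And>w. w \<in> lang N \<Longrightarrow> w \<in> FIFO"
    and bound: "\<And>w. w \<in> lang N \<Longrightarrow> sum_bounded_word 1 w"
    using assms(1) unfolding sigma1_psm_def psm_def core_lang_def N_def by blast+
  \<comment> \<open>Expanding paired events keeps sink-finality: an intermediate state is not final
    and has its receive as an exit.\<close>
  have sink: "sink_final N"
    unfolding sink_final_def
  proof
    fix x assume "x \<in> states N"
    then consider (old) s where "x = Inl s" "s \<in> states M"
      | (new) s c s' where "x = Inr (s, c, s')" "(s, Some (paired c), s') \<in> delta M"
      unfolding N_def unpair_def by auto
    then show "x \<in> finals N \<longleftrightarrow> outgoing N x = {}"
    proof cases
      case old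
      have "outgoing N x = {} \<longleftrightarrow> outgoing M s = {}"
      proof
        assume "outgoing N x = {}"
        then have no: "(Inl s, l, y) \<notin> delta N" for l y using old(1) by (auto simp: outgoing_def)
        have "(s, l, s') \<notin> delta M" for l s'
        proof (cases l)
          case None
          then show ?thesis using no[of None "Inl s'"] by (auto simp: N_def unpair_Inl_None)
        next
          case (Some a)
          show ?thesis
          proof (cases a)
            case (Event e)
            then show ?thesis
              using no[of "Some e" "Inl s'"] Some by (auto simp: N_def unpair_Inl_Some)
          next
            case (Paired p q m)
            then show ?thesis
              using no[of "Some (Snd p q m)" "Inr (s, (p, q, m), s')"] Some
              by (auto simp: N_def unpair_Inl_Some)
          qed
        qed
        then show "outgoing M s = {}" by (auto simp: outgoing_def)
      next
        assume "outgoing M s = {}"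
        then have no: "(s, l, y) \<notin> delta M" for l y by (auto simp: outgoing_def)
        have "(Inl s, l, y) \<notin> delta N" for l y
          by (cases l) (simp_all add: N_def unpair_Inl_None unpair_Inl_Some no)
        then show "outgoing N x = {}" using old(1) by (auto simp: outgoing_def)
      qed
      then show ?thesis using old assms(2) by (simp add: N_def sink_final_def)
    next
      case new
      then have "(x, Some (rcv_of c), Inl s') \<in> outgoing N x"
        by (simp add: outgoing_def N_def unpair_Inr)
      then show ?thesis using new(1) by (auto simp: N_def)
    qed
  qed
  obtain Z Q where alt: "alternating N Z Q"
    using sum_1_bounded_alternating[OF fsm sink fifo bound] by blast
  \<comment> \<open>Participants, messages and states are finite, so the interactions from a state
    fit into a list. Its distinctness is used for the labels of the branches.\<close>
  define succs where "succs s = (SOME xs. set xs = {(c, s'). pstep N s c s'} \<and> distinct xs)" for s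
  have "finite {(c, s'). pstep N s c s'}" for s
  proof (rule finite_subset)
    show "{(c, s'). pstep N s c s'} \<subseteq> UNIV \<times> states N"
      using wstep_states[OF fsm] unfolding pstep_def by auto
    show "finite ((UNIV :: ('p, 'v) interaction set) \<times> states N)"
      using fsm by (simp add: is_fsm_def)
  qed
  then have succs: "set (succs s) = {(c, s'). pstep N s c s'}" "distinct (succs s)" for s
    unfolding succs_def using someI_ex[OF finite_distinct_list] by blast+
  interpret interaction_graph "states N" succs "start N"
  proof
    show "finite (states N)" "start N \<in> states N" using fsm by (auto simp: is_fsm_def)
    show "s' \<in> states N" if "(c, s') \<in> set (succs s)" for s c s'
      using that wstep_states[OF fsm] unfolding succs pstep_def by blast
    show "p \<noteq> q" if step: "((p, q, m), s') \<in> set (succs s)" for s p q m s'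
    proof -
      obtain t where "wstep N s (Snd p q m) t" using step unfolding succs pstep_def by auto
      from wstep_label[OF fsm this] show ?thesis by (simp add: Sigma_ev_def)
    qed
  qed

  \<comment> \<open>From left to right, density and sink-finality forbid interactions at terminating
    states. Conversely \<open>progress\<close> gives a send and, since a state awaiting a receive
    does not terminate, also the receive.\<close>
  have terminal: "terminates N s \<longleftrightarrow> succs s = []" if s: "s \<in> Z" "s \<in> states N" for s
  proof
    assume "terminates N s"
    then have "\<not> pstep N s c s'" for c s'
      using wstep_not_terminates[OF fsm dense sink] unfolding pstep_def by blast
    then have "set (succs s) = {}" unfolding succs by simp
    then show "succs s = []" by simp
  next
    assume none: "succs s = []"
    show "terminates N s"
    proof (rule ccontr)
      assume "\<not> terminates N s"
      then obtain a t where t: "wstep N s a t" using progress[OF fsm sink s(2)] by blast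
      then obtain c where c: "a = snd_of c" "t \<in> Q c" using alternating_sndD[OF alt s(1)] by blast
      obtain b s' where b: "wstep N t b s'"
        using progress[OF fsm sink wstep_states[OF fsm t] alternating_rcvD(1)[OF alt c(2)]] by blast
      then have "pstep N s c s'"
        using t c(1) alternating_rcvD(2)[OF alt c(2) b] unfolding pstep_def by blast
      then have "(c, s') \<in> set (succs s)" unfolding succs by simp
      then show False using none by simp
    qed
  qed
  have step_Z: "s' \<in> Z \<and> s' \<in> states N" if s: "s \<in> Z" and step: "pstep N s c s'" for s c s'
  proof -
    obtain t where t: "wstep N s (snd_of c) t" "wstep N t (rcv_of c) s'"
      using step unfolding pstep_def by blast
    obtain d where "t \<in> Q d" using alternating_sndD[OF alt s t(1)] by blast
    then show ?thesis using alternating_rcvD(3)[OF alt _ t(2)] wstep_states[OF fsm t(2)] by blast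
  qed

  \<comment> \<open>A bisimulation for interactions and termination; each of its directions yields
    one inclusion of languages.\<close>
  define R :: "(nat list, 'p, 'v) ustate \<Rightarrow> ('s, 'p, 'v) ustate \<Rightarrow> bool"
    where "R x s \<longleftrightarrow> s \<in> Z \<and> s \<in> states N \<and> (\<exists>\<pi>. x = Inl \<pi> \<and> located \<pi> s)" for x s
  have start: "R (start (GU G)) (start N)"
    using alt located_root fsm unfolding R_def alternating_def is_fsm_def
    by (simp add: unpair_def GAut_def)
  have fin: "terminates (GU G) x \<longleftrightarrow> terminates N s" if "R x s" for x s
    using that terminal located_terminates unfolding R_def by blast
  have "simulates R (GU G) N"
    unfolding simulates_def
  proof (intro conjI allI impI)
    fix x s c x' assume R: "R x s" and step: "pstep (GU G) x c x'"
    obtain \<pi> where \<pi>: "x = Inl \<pi>" "located \<pi> s" using R unfolding R_def by blast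
    obtain \<rho> s' where "x' = Inl \<rho>" "(c, s') \<in> set (succs s)" "located \<rho> s'"
      using located_pstep_forward[OF \<pi>(2)] step unfolding \<pi>(1) by blast
    then show "\<exists>s'. pstep N s c s' \<and> R x' s'"
      using R step_Z unfolding R_def succs by blast
  qed (use start fin in blast)+
  then have "lang (GU G) \<subseteq> lang N" by (rule simulates_lang[OF GU_alternating])
  moreover have "simulates (\<lambda>s x. R x s) N (GU G)"
    unfolding simulates_def
  proof (intro conjI allI impI)
    fix s x c s' assume R: "R x s" and step: "pstep N s c s'"
    obtain \<pi> where \<pi>: "x = Inl \<pi>" "located \<pi> s" using R unfolding R_def by blast
    have "(c, s') \<in> set (succs s)" using step unfolding succs by simp
    from located_pstep_backward[OF \<pi>(2) this]
    show "\<exists>x'. pstep (GU G) x c x' \<and> R x' s'"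
      using R step_Z[OF _ step] unfolding R_def \<pi>(1) by blast
  qed (use start fin in blast)+
  then have "lang N \<subseteq> lang (GU G)" by (rule simulates_lang[OF alt])
  ultimately have lang: "core_lang (GAut G) = core_lang M" unfolding core_lang_def N_def by blast

  have "gtype_choice c G" if c: "psm_choice c M" for c
  proof -
    \<comment> \<open>The list has no repetitions, so a repeated label would need two different
      targets.\<close>
    have inj: "distinct (map fst (succs s))"
      if "\<And>c s1 s2. pstep N s c s1 \<Longrightarrow> pstep N s c s2 \<Longrightarrow> s1 = s2" for s
      using that succs(2)[of s] unfolding distinct_map inj_on_def succs by auto
    \<comment> \<open>Each choice restriction concerns only the labels of the branches, and these
      are the labels of a successor list.\<close>
    have lift: "all_choices P G"
      if "\<And>s bs. map fst bs = map fst (succs s) \<Longrightarrow> P bs" for P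
      unfolding all_choices_def
    proof (intro allI impI)
      fix \<pi> bs
      assume "subterm_at G \<pi> = Some (Choice bs)"
      then obtain \<rho> n env s where "bs = branches n \<rho> env s" using subterm_Choice by blast
      then show "P bs" by (intro that[of _ s]) (simp add: map_fst_branches)
    qed
    have mem: "\<exists>s'. pstep N s c s'"
      if "map fst bs = map fst (succs s)" "c \<in> fst ` set bs"
      for bs :: "(('p, 'v) interaction \<times> ('p, 'v) gtype) list" and s c
    proof -
      have "c \<in> set (map fst (succs s))" unfolding that(1)[symmetric] using that(2) by simp
      then show ?thesis using succs(1)[of s] by auto
    qed
    have sd_distinct: "distinct (map fst (succs s))" if "sender_driven N" for s
      by (rule inj) (rule sender_driven_pstep(1)[OF fsm dense that _ _ refl])
    show ?thesis
    proof (cases c)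
      case Non_Deterministic
      then show ?thesis by simp
    next
      case Mixed_Choice
      then have det: "deterministic N" using c by (simp add: N_def)
      have "distinct (map fst (succs s))" for s
        by (rule inj) (rule deterministic_pstep[OF fsm dense det])
      then show ?thesis unfolding Mixed_Choice gtype_choice.simps by (intro lift) simp
    next
      case Sender_Driven
      then have sd: "sender_driven N" using c by (simp add: N_def)
      show ?thesis
        unfolding Sender_Driven gtype_choice.simps
      proof (rule lift)
        fix s and bs :: "(('p, 'v) interaction \<times> ('p, 'v) gtype) list"
        assume bs: "map fst bs = map fst (succs s)"
        have "fst (fst x) = fst (fst y)" if xy: "x \<in> set bs" "y \<in> set bs" for x y
          using mem[OF bs imageI[OF xy(1)]] mem[OF bs imageI[OF xy(2)]]
            sender_driven_pstep(2)[OF fsm dense sd] by blast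
        then show "distinct (map fst bs) \<and> common (\<lambda>((p, q, m), G'). p) bs"
          unfolding common_def split_beta bs using sd_distinct[OF sd] by blast
      qed
    next
      case Directed
      then have dir: "directed N" using c by (simp add: N_def)
      then have sd: "sender_driven N" by (simp add: directed_def)
      show ?thesis
        unfolding Directed gtype_choice.simps
      proof (rule lift)
        fix s and bs :: "(('p, 'v) interaction \<times> ('p, 'v) gtype) list"
        assume bs: "map fst bs = map fst (succs s)"
        have dist: "distinct (map fst bs)" unfolding bs by (rule sd_distinct[OF sd])
        have same: "fst (fst x) = fst (fst y) \<and> fst (snd (fst x)) = fst (snd (fst y))"
          if xy: "x \<in> set bs" "y \<in> set bs" for x y
          using mem[OF bs imageI[OF xy(1)]] mem[OF bs imageI[OF xy(2)]]
            sender_driven_pstep(2,3)[OF fsm dense sd] dir by blast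
        have "common (\<lambda>((p, q, m), G'). p) bs" "common (\<lambda>((p, q, m), G'). q) bs"
          unfolding common_def split_beta using same by blast+
        moreover have "distinct (map (\<lambda>((p, q, m), G'). m) bs)"
          unfolding distinct_map
        proof
          show "distinct bs" using dist by (simp add: distinct_map)
          show "inj_on (\<lambda>((p, q, m), G'). m) (set bs)"
          proof (rule inj_onI)
            fix x y
            assume xy: "x \<in> set bs" "y \<in> set bs"
              and eq: "(\<lambda>((p, q, m), G'). m) x = (\<lambda>((p, q, m), G'). m) y"
            \<comment> \<open>With sender and receiver in common, the message determines the
              interaction.\<close>
            have "fst x = fst y"
              using same[OF xy] eq by (simp add: split_beta prod_eq_iff)
            then show "x = y" using dist xy unfolding distinct_map by (blast dest: inj_onD)
          qed
        qed
        ultimately show "common (\<lambda>((p, q, m), G'). p) bs \<and> common (\<lambda>((p, q, m), G'). q) bs \<and>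
            distinct (map (\<lambda>((p, q, m), G'). m) bs)"
          by blast
      qed
    qed
  qed
  then show ?thesis
    using global_type_G lang unfolding semantics_def by (intro exI[of _ G]) simp
qed

end
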